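(* Let $\ell>0$ be a real number and let $m$ be a positive even integer. Let $\kappa(\boldsymbol r)=\frac{\|\boldsymbol r\|_2^2}{2\ell^2}\exp\!\left(-\frac{\|\boldsymbol r\|_2^2}{2\ell^2}\right)$ for $\boldsymbol r\in[-1/2,1/2]^3$ be the trivariate derivative Gaussian kernel, continued $1$-periodically in each coordinate, and let $\kappa_{\mathrm{ERR}}=\kappa-\kappa_{\mathrm F}$ be its Fourier approximation error, where $\kappa_{\mathrm F}$ is the trigonometric polynomial built from the discrete Fourier coefficients of $\kappa$ on the equispaced grid with $m^3$ points (see context). Put $\eta:=\frac{\ell\pi m}{\sqrt2}$ and assume $\eta\ge1$. Then $$\|\kappa_{\mathrm{ERR}}\|_\infty<\left(\frac52\,\xi(\eta,\ell)+15\,\gamma(\eta,\ell)\right)\bigl(15+12\,\gamma(\eta,\ell)\bigr)+75\,S(\eta,\ell)+6\,A(\eta,\ell)\left(\frac{116}{5}S(\eta,\ell)+87\right),$$ where $$\gamma(\eta,\ell):=\ell\sqrt{2\pi}\,e^{-\eta^2}+\begin{cases}\dfrac{e^{-1/(8\ell^2)}}{\eta^2} & \text{if } \ell<\frac12,\\[2mm] \dfrac{2\ell e^{-1/2}}{\eta^2} & \text{if } \ell\ge\frac12,\end{cases}$$ $$A(\eta,\ell):=\frac{1}{2\eta\sqrt\pi}\,e^{-\eta^2}+\begin{cases}\dfrac{e^{-1/(8\ell^2)}}{\sqrt2\,\ell\pi\eta} & \text{if } \ell<\frac12,\\[2mm] \dfrac{\sqrt2\,e^{-1/2}}{\pi\eta}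 & \text{if } \ell\ge\frac12,\end{cases}$$ $$\xi(\eta,\ell):=\left(\eta^2+\tfrac12\right)\ell\sqrt{2\pi}\,e^{-\eta^2}+\begin{cases}\dfrac{e^{-1/(8\ell^2)}}{8\eta^2\ell^2} & \text{if } \ell\le\frac12\sqrt{\frac{2}{5+\sqrt{17}}},\\[2mm] \dfrac1{\eta^2}+\dfrac{3\ell}{2\eta^2} & \text{otherwise},\end{cases}$$ and $$S(\eta,\ell):=\frac{\operatorname{erfc}(\eta)}4+\frac{\eta}{2\sqrt\pi}e^{-\eta^2}+\frac1{4\sqrt\pi\,\eta}e^{-\eta^2}+\begin{cases}\dfrac{e^{-1/(8\ell^2)}}{8\sqrt2\,\pi\ell^3\eta} & \text{if } \ell\le\frac12\sqrt{\frac{2}{5+\sqrt{17}}},\\[2mm] \dfrac1{\sqrt2\,\pi\ell\eta}+\dfrac{3}{2\sqrt2\,\pi\eta} & \text{otherwise}.\end{cases}$$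
   Context: Let $m$ be a positive even integer and $\mathcal I_m:=\{\boldsymbol k\in\mathbb Z^3: -\frac m2\le k_j<\frac m2 \text{ for } j=1,2,3\}$. A kernel $\kappa:[-1/2,1/2]^3\to\mathbb R$ (even in each coordinate) is regarded as a function on the torus $\mathbb T^3$ by simple $1$-periodic continuation in each coordinate. Its discrete Fourier coefficients are $$\hat c_{\boldsymbol k}:=\frac1{m^3}\sum_{\boldsymbol j\in\mathcal I_m}\kappa\!\left(\frac{\boldsymbol j}{m}\right)e^{-2\pi \mathrm i\,\boldsymbol j^{\top}\boldsymbol k/m},\qquad \boldsymbol k\in\mathcal I_m,$$ the Fourier approximation of $\kappa$ is $$\kappa_{\mathrm F}(\boldsymbol r):=\sum_{\boldsymbol k\in\mathcal I_m}\hat c_{\boldsymbol k}\,e^{2\pi \mathrm i\,\boldsymbol k^{\top}\boldsymbol r},$$ and the approximation error is $\kappa_{\mathrm{ERR}}(\boldsymbol r):=\kappa(\boldsymbol r)-\kappa_{\mathrm F}(\boldsymbol r)$, with $$\|\kappa_{\mathrm{ERR}}\|_\infty:=\max_{\boldsymbol r\in[-1/2,1/2]^3}|\kappa_{\mathrm{ERR}}(\boldsymbol r)|.$$ The complementary error function is $\operatorname{erfc}(x):=1-\frac2{\sqrt\pi}\int_0^x e^{-t^2}\,\mathrm dt$. *)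

theory Defs
  imports "HOL-Analysis.Analysis"
begin

definition erfc :: "real \<Rightarrow> real" where
  "erfc x = 1 - 2 / sqrt pi * (LBINT t=0..x. exp (- (t\<^sup>2)))"

definition unit_cube :: "(real ^ 3) set" where
  "unit_cube = {r. \<forall>i. - 1/2 \<le> r $ i \<and> r $ i \<le> 1/2}"

(* Since round x is the floor of x + 1/2, the representative x - round x lies in [-1/2, 1/2).
   On the faces r $ i = 1/2 this agrees with f whenever f is even in each coordinate. *)
definition periodic_cont :: "(real ^ 3 \<Rightarrow> real) \<Rightarrow> real ^ 3 \<Rightarrow> real" where
  "periodic_cont f r = f (\<chi> i. r $ i - of_int (round (r $ i)))"

definition index_set :: "nat \<Rightarrow> (int ^ 3) set" where
  "index_set m = {k. \<forall>i. - real m / 2 \<le> of_int (k $ i) \<and> of_int (k $ i) < real m / 2}"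

definition of_int_vec :: "int ^ 3 \<Rightarrow> real ^ 3" where
  "of_int_vec k = (\<chi> i. of_int (k $ i))"

definition fourier_coeff :: "(real ^ 3 \<Rightarrow> real) \<Rightarrow> nat \<Rightarrow> int ^ 3 \<Rightarrow> complex" where
  "fourier_coeff \<kappa> m k =
     1 / of_nat m ^ 3 *
     (\<Sum>j\<in>index_set m. of_real (\<kappa> ((1 / real m) *\<^sub>R of_int_vec j)) *
        exp (- 2 * of_real pi * \<i> * of_real (of_int_vec j \<bullet> of_int_vec k) / of_nat m))"

definition fourier_approx :: "(real ^ 3 \<Rightarrow> real) \<Rightarrow> nat \<Rightarrow> real ^ 3 \<Rightarrow> complex" where
  "fourier_approx \<kappa> m r =
     (\<Sum>k\<in>index_set m. fourier_coeff \<kappa> m k *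
        exp (2 * of_real pi * \<i> * of_real (of_int_vec k \<bullet> r)))"

(* Complex-valued: for even m the index set is not symmetric under negation,
   so the approximation of a real kernel need not be real off the grid. *)
definition fourier_err :: "(real ^ 3 \<Rightarrow> real) \<Rightarrow> nat \<Rightarrow> real ^ 3 \<Rightarrow> complex" where
  "fourier_err \<kappa> m r = of_real (\<kappa> r) - fourier_approx \<kappa> m r"

(* For g continuous on the (compact) cube this supremum is a maximum. *)
definition sup_norm_cube :: "(real ^ 3 \<Rightarrow> complex) \<Rightarrow> real" where
  "sup_norm_cube g = (SUP r\<in>unit_cube. norm (g r))"

definition der_gauss :: "real \<Rightarrow> real ^ 3 \<Rightarrow> real" where
  "der_gauss l r = (norm r)\<^sup>2 / (2 * l\<^sup>2) * exp (- ((norm r)\<^sup>2 / (2 * l\<^sup>2)))"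

definition der_gauss_kernel :: "real \<Rightarrow> real ^ 3 \<Rightarrow> real" where
  "der_gauss_kernel l = periodic_cont (der_gauss l)"

definition gamma_term :: "real \<Rightarrow> real \<Rightarrow> real" where
  "gamma_term \<eta> l =
     l * sqrt (2 * pi) * exp (- (\<eta>\<^sup>2)) +
     (if l < 1/2 then exp (- (1 / (8 * l\<^sup>2))) / \<eta>\<^sup>2
      else 2 * l * exp (- (1/2)) / \<eta>\<^sup>2)"

definition A_term :: "real \<Rightarrow> real \<Rightarrow> real" where
  "A_term \<eta> l =
     1 / (2 * \<eta> * sqrt pi) * exp (- (\<eta>\<^sup>2)) +
     (if l < 1/2 then exp (- (1 / (8 * l\<^sup>2))) / (sqrt 2 * l * pi * \<eta>)
      else sqrt 2 * exp (- (1/2)) / (pi * \<eta>))"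

definition xi_term :: "real \<Rightarrow> real \<Rightarrow> real" where
  "xi_term \<eta> l =
     (\<eta>\<^sup>2 + 1/2) * l * sqrt (2 * pi) * exp (- (\<eta>\<^sup>2)) +
     (if l \<le> 1/2 * sqrt (2 / (5 + sqrt 17))
      then exp (- (1 / (8 * l\<^sup>2))) / (8 * \<eta>\<^sup>2 * l\<^sup>2)
      else 1 / \<eta>\<^sup>2 + 3 * l / (2 * \<eta>\<^sup>2))"

definition S_term :: "real \<Rightarrow> real \<Rightarrow> real" where
  "S_term \<eta> l =
     erfc \<eta> / 4 + \<eta> / (2 * sqrt pi) * exp (- (\<eta>\<^sup>2)) +
     1 / (4 * sqrt pi * \<eta>) * exp (- (\<eta>\<^sup>2)) +
     (if l \<le> 1/2 * sqrt (2 / (5 + sqrt 17))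
      then exp (- (1 / (8 * l\<^sup>2))) / (8 * sqrt 2 * pi * l ^ 3 * \<eta>)
      else 1 / (sqrt 2 * pi * l * \<eta>) + 3 / (2 * sqrt 2 * pi * \<eta>))"

end

theory Submission
  imports Defs "HOL-Probability.Characteristic_Functions"
begin

text \<open>
  The kernel is a sum of three tensor products of the Gaussian g and of f(x) = x^2 / (2 l^2) g(x), and the
  interpolation on the grid respects tensor products. Hence everything reduces to the errors of the
  one-dimensional interpolants of g and f. For an even function with absolutely summable cosine coefficients
  a_k, aliasing bounds this error by 2 |a_M| + 4 (|a_(M+1)| + |a_(M+2)| + ...), where M = m / 2. The
  coefficients are integrals over the whole line, which are explicit, minus tails over |x| > 1/2, which two
  integrations by parts bound by the total variation of the derivative. This gives |a_k| \<le> gamma_term t l for g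
  and |a_k| \<le> xi_term t l for f, with t = sqrt 2 pi l k, which is \<eta> for k = M. The functions A_term and S_term
  have derivatives in t that dominate these bounds, so they bound the sums over k > M. Crude numerical bounds on
  the four terms then absorb the products that arise from the three factors.
\<close>


section \<open>Cosine series\<close>

text \<open>The obstacle is the periodic continuation: in general it has a kink where a coordinate
  is a half-integer, so the coefficients of a Gaussian on the torus decay only like 1/k^2.
  Completing the integral to the whole line separates the two effects. The smooth part contributes
  the multiples of exp (- t^2), the kink contributes C / t^2, and each of the four error terms is
  such a pair. The tensor estimate produced here is 3 * (\<beta> * (1 + \<alpha>)^2 + 2 * \<alpha> +
  \<alpha>^2), where \<alpha> and \<beta> bound the one-dimensional errors of g and f. It is cubic
  in the error terms, while the claim is quadratic and has no products of \<open>gamma_term\<close>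
  with \<open>S_term\<close> or of \<open>A_term\<close> with \<open>xi_term\<close>. Absolute
  bounds on the terms are therefore indispensable. They rest on \<eta> \<ge> 1 and on l \<le> \<eta>
  / (sqrt 2 * pi), which keeps l / \<eta> bounded even though l alone is not.\<close>

lemma integral_cos_half_period:
  "integral {0..1/2} (\<lambda>x. cos (2 * pi * of_int j * x)) = (if j = 0 then 1/2 else 0)"
proof (cases "j = 0")
  case False
  have "((\<lambda>x. cos (2 * pi * of_int j * x)) has_integral
      sin (2 * pi * of_int j * (1/2)) / (2 * pi * of_int j) - sin (2 * pi * of_int j * 0) / (2 * pi * of_int j)) {0..1/2::real}"
    using False
    by (intro fundamental_theorem_of_calculus)
       (auto intro!: derivative_eq_intros simp flip: has_real_derivative_iff_has_vector_derivative)
  moreover have "sin (2 * pi * of_int j * (1/2)) = 0"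
    using sin_integer_2pi[of "of_int j"] sin_npi_int[of j] by (simp add: mult.commute)
  ultimately show ?thesis using False by (simp add: integral_unique)
qed simp

lemma integral_cos_mult_cos_half_period:
  "integral {0..1/2} (\<lambda>x. cos (2 * pi * real j * x) * cos (2 * pi * real k * x)) =
     (if j = k then if j = 0 then 1/2 else 1/4 else 0)"
proof -
  have eq: "cos (2 * pi * real j * x) * cos (2 * pi * real k * x) =
      (cos (2 * pi * of_int (int j - int k) * x) + cos (2 * pi * of_int (int j + int k) * x)) / 2" for x
    by (simp add: cos_times_cos algebra_simps)
  have i: "(\<lambda>x. cos (2 * pi * of_int i * x)) integrable_on {0..1/2::real}" for i :: int
    by (intro integrable_continuous_real continuous_intros)
  show ?thesis
    unfolding eq
    using integral_add[OF i i, of "int j - int k" "int j + int k"]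
    unfolding integral_cos_half_period by auto
qed

text \<open>The hypothesis makes F orthogonal to all powers of cos (2 pi x), hence, by Weierstrass in the variable
  y = cos (2 pi x), to every continuous function and in particular to itself.\<close>
lemma zero_of_cos_moments_zero:
  fixes F :: "real \<Rightarrow> real"
  assumes F: "continuous_on {0..1/2} F"
    and orth: "\<And>k::nat. integral {0..1/2} (\<lambda>x. F x * cos (2 * pi * real k * x)) = 0"
    and x: "x \<in> {0..1/2}"
  shows "F x = 0"
proof -
  \<comment> \<open>Integer frequencies, because the induction below passes from k to k - 1 and k +
    1.\<close>
  have orth_int: "integral {0..1/2} (\<lambda>x. F x * cos (2 * pi * of_int k * x)) = 0" for k :: int
  proof (cases "k \<ge> 0")
    case True
    then show ?thesis using orth[of "nat k"] by simp
  next
    case False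
    then show ?thesis using orth[of "nat (-k)"] by simp
  qed
  have int: "(\<lambda>x. F x * cos (2 * pi * x) ^ n * cos (2 * pi * of_int k * x)) integrable_on {0..1/2}"
    for n and k :: int
    by (intro integrable_continuous_real continuous_intros F)
  \<comment> \<open>One power of the cosine is traded for the two neighbouring frequencies, hence
    the statement for all k at once.\<close>
  have pow: "integral {0..1/2} (\<lambda>x. F x * cos (2 * pi * x) ^ n * cos (2 * pi * of_int k * x)) = 0"
    for n and k :: int
  proof (induction n arbitrary: k)
    case 0
    then show ?case using orth_int by simp
  next
    case (Suc n)
    have eq: "F x * cos (2 * pi * x) ^ Suc n * cos (2 * pi * of_int k * x) =
      (F x * cos (2 * pi * x) ^ n * cos (2 * pi * of_int (k - 1) * x) +
       F x * cos (2 * pi * x) ^ n * cos (2 * pi * of_int (k + 1) * x)) / 2" for x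
    proof -
      have "cos (2 * pi * x) * cos (2 * pi * of_int k * x) =
        (cos (2 * pi * of_int (k - 1) * x) + cos (2 * pi * of_int (k + 1) * x)) / 2"
        by (subst mult.commute, subst cos_times_cos) (simp add: algebra_simps)
      then have "F x * cos (2 * pi * x) ^ n * (cos (2 * pi * x) * cos (2 * pi * of_int k * x)) =
        F x * cos (2 * pi * x) ^ n *
          ((cos (2 * pi * of_int (k - 1) * x) + cos (2 * pi * of_int (k + 1) * x)) / 2)"
        by (rule arg_cong)
      then show ?thesis by (simp only: power_Suc distrib_left times_divide_eq_right mult_ac)
    qed
    show ?case
      unfolding eq using integral_add[OF int int, of n "k-1" n "k+1"] Suc[of "k-1"] Suc[of "k+1"] by simp
  qed
  have pow0: "integral {0..1/2} (\<lambda>x. F x * cos (2 * pi * x) ^ n) = 0" for n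
    using pow[of n 0] by simp
  obtain B where B: "B > 0" "\<And>x. x \<in> {0..1/2} \<Longrightarrow> \<bar>F x\<bar> \<le> B"
  proof -
    have "bounded (F ` {0..1/2})"
      using compact_continuous_image[OF F] compact_imp_bounded by auto
    then show ?thesis unfolding bounded_pos using that by auto
  qed
  \<comment> \<open>Since F is orthogonal to p (cos (2 pi x)), the integral of F * F is that of F *
    (F - p (cos (2 pi x))). The tolerance e / B for p cancels the bound B on F.\<close>
  have sq: "\<bar>integral {0..1/2} (\<lambda>x. F x * F x)\<bar> \<le> e" if e: "e > 0" for e
  proof -
    define G where "G = (\<lambda>y. F (arccos y / (2 * pi)))"
    have "continuous_on {-1..1} G"
      unfolding G_def
    proof (rule continuous_on_compose2[OF F])
      show "continuous_on {-1..1::real} (\<lambda>x. arccos x / (2 * pi))"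
        by (intro continuous_intros) auto
      show "(\<lambda>x. arccos x / (2 * pi)) ` {- 1..1} \<subseteq> {0..1/2}"
        using arccos_lbound arccos_ubound by (auto simp: field_simps)
    qed
    then obtain p where p: "real_polynomial_function p" "\<And>y. y \<in> {-1..1} \<Longrightarrow> \<bar>G y - p y\<bar> < e / B"
      using Stone_Weierstrass_real_polynomial_function[of "{-1..1}" G "e / B"] e B by auto
    obtain a n where an: "p = (\<lambda>x. \<Sum>i\<le>n. a i * x ^ i)"
      using p(1) real_polynomial_function_iff_sum by metis
    have Fp: "\<bar>F x - p (cos (2 * pi * x))\<bar> < e / B" if "x \<in> {0..1/2}" for x
    proof -
      have "0 \<le> 2 * pi * x" "2 * pi * x \<le> pi" using that by auto
      then have "arccos (cos (2 * pi * x)) = 2 * pi * x" by (rule arccos_cos)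
      then have "G (cos (2 * pi * x)) = F x" by (simp add: G_def)
      then show ?thesis using p(2)[of "cos (2 * pi * x)"] by auto
    qed
    have Fp0: "integral {0..1/2} (\<lambda>x. F x * p (cos (2 * pi * x))) = 0"
    proof -
      have "integral {0..1/2} (\<lambda>x. F x * p (cos (2 * pi * x))) =
        integral {0..1/2} (\<lambda>x. \<Sum>i\<le>n. a i * (F x * cos (2 * pi * x) ^ i))"
        unfolding an by (simp add: sum_distrib_left algebra_simps)
      also have "\<dots> = (\<Sum>i\<le>n. integral {0..1/2} (\<lambda>x. a i * (F x * cos (2 * pi * x) ^ i)))"
        by (rule integral_sum) (auto intro!: integrable_continuous_real continuous_intros F)
      also have "\<dots> = 0" using pow0 by simp
      finally show ?thesis .
    qed
    have ci: "(\<lambda>x. F x * F x) integrable_on {0..1/2}"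
        "(\<lambda>x. F x * p (cos (2 * pi * x))) integrable_on {0..1/2}"
      unfolding an by (intro integrable_continuous_real continuous_intros F)+
    have "integral {0..1/2} (\<lambda>x. F x * F x) =
      integral {0..1/2} (\<lambda>x. F x * F x - F x * p (cos (2 * pi * x)))"
      using integral_diff[OF ci] Fp0 by simp
    also have "norm \<dots> \<le> e * (1/2 - 0)"
    proof (rule integral_bound)
      show "continuous_on {0..1/2} (\<lambda>x. F x * F x - F x * p (cos (2 * pi * x)))"
        unfolding an by (intro continuous_intros F)
      fix x :: real assume x: "x \<in> {0..1/2}"
      have "\<bar>F x\<bar> * \<bar>F x - p (cos (2 * pi * x))\<bar> \<le> B * (e / B)"
        using B(2)[OF x] Fp[OF x] B(1) by (intro mult_mono) auto
      then show "norm (F x * F x - F x * p (cos (2 * pi * x))) \<le> e"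
        using B(1) by (simp flip: abs_mult add: algebra_simps)
    qed simp
    finally show ?thesis using e by simp
  qed
  then have "integral {0..1/2} (\<lambda>x. F x * F x) = 0"
    by (metis abs_le_zero_iff dense_ge)
  then have "\<forall>x\<in>{0..1/2}. F x * F x = 0"
    by (subst (asm) integral_eq_0_iff) (auto intro!: continuous_intros F)
  then show ?thesis using x by auto
qed

text \<open>For even h this is the integral of h x * cos (2 pi k x) over a full period, that is, the
  k-th complex Fourier coefficient. The cosine series therefore has weight 1 at k = 0 and weight 2
  at every other k.\<close>

definition cos_coeff :: "(real \<Rightarrow> real) \<Rightarrow> nat \<Rightarrow> real" where
  "cos_coeff h k = 2 * integral {0..1/2} (\<lambda>x. h x * cos (2 * pi * real k * x))"

text \<open>By the M-test the series converges uniformly to a continuous s and may be integrated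
  term by term. Thus h and s have the same cosine coefficients, and
  \<open>zero_of_cos_moments_zero\<close> applies to h - s.\<close>

theorem cos_series_sums:
  fixes h :: "real \<Rightarrow> real"
  defines "b \<equiv> \<lambda>k. if k = 0 then cos_coeff h 0 else 2 * cos_coeff h k"
  assumes h: "continuous_on {0..1/2} h" and summ: "summable (\<lambda>k. \<bar>b k\<bar>)"
    and x: "x \<in> {0..1/2}"
  shows "(\<lambda>k. b k * cos (2 * pi * real k * x)) sums h x"
proof -
  define s where "s x = (\<Sum>j. b j * cos (2 * pi * real j * x))" for x
  have le: "\<bar>b j * cos (2 * pi * real j * x)\<bar> \<le> \<bar>b j\<bar>" for j x
    using mult_left_mono[OF abs_cos_le_one, of "\<bar>b j\<bar>"] by (simp add: abs_mult)
  have "uniform_limit {0..1/2} (\<lambda>n x. \<Sum>j<n. b j * cos (2 * pi * real j * x)) s sequentially"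
    unfolding s_def by (rule Weierstrass_m_test[OF _ summ]) (use le in auto)
  then have cs: "continuous_on {0..1/2} s"
    by (rule uniform_limit_theorem[rotated]) (auto intro!: always_eventually continuous_intros)
  have sum: "(\<lambda>j. b j * cos (2 * pi * real j * x)) sums s x" for x
    unfolding s_def by (intro summable_sums summable_comparison_test'[OF summ]) (use le in auto)
  have coeff: "integral {0..1/2} (\<lambda>x. s x * cos (2 * pi * real k * x)) = cos_coeff h k / 2" for k
  proof -
    let ?t = "\<lambda>j x. b j * cos (2 * pi * real j * x) * cos (2 * pi * real k * x)"
    have ule: "\<bar>?t j x\<bar> \<le> \<bar>b j\<bar>" for j x
      using mult_mono[OF le[of j x] abs_cos_le_one[of "2 * pi * real k * x"]] by (simp add: abs_mult)
    have lim: "(\<lambda>x. \<Sum>j. ?t j x) = (\<lambda>x. s x * cos (2 * pi * real k * x))"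
      using sums_mult2[OF sum] by (auto simp: sums_iff)
    have u: "uniform_limit {0..1/2} (\<lambda>n x. \<Sum>j<n. ?t j x) (\<lambda>x. s x * cos (2 * pi * real k * x)) sequentially"
      unfolding lim[symmetric] by (rule Weierstrass_m_test[OF _ summ]) (use ule in auto)
    obtain I J where I: "\<And>n. ((\<lambda>x. \<Sum>j<n. ?t j x) has_integral I n) {0..1/2}"
        and J: "((\<lambda>x. s x * cos (2 * pi * real k * x)) has_integral J) {0..1/2}"
        and IJ: "I \<longlonglongrightarrow> J"
      by (rule uniform_limit_integral[OF u]) (auto intro!: continuous_intros)
    have ci: "(\<lambda>x. cos (2 * pi * real j * x) * cos (2 * pi * real k * x)) integrable_on {0..1/2::real}" for j
      by (intro integrable_continuous_real continuous_intros)
    \<comment> \<open>Orthogonality leaves only the summand j = k, so I is constant from n = k + 1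
      on. The values 1/2 and 1/4 of the cosine integrals compensate the weights 1 and 2 in
      b.\<close>
    have In: "I n = cos_coeff h k / 2" if "n > k" for n
    proof -
      have "I n = integral {0..1/2} (\<lambda>x. \<Sum>j<n. b j * (cos (2 * pi * real j * x) * cos (2 * pi * real k * x)))"
        using I[of n] by (simp add: integral_unique mult.assoc)
      also have "\<dots> = (\<Sum>j<n. integral {0..1/2} (\<lambda>x. b j * (cos (2 * pi * real j * x) * cos (2 * pi * real k * x))))"
        by (rule integral_sum) (auto intro!: integrable_continuous_real continuous_intros)
      also have "\<dots> = (\<Sum>j<n. if k = j then b j * (if j = 0 then 1/2 else 1/4) else 0)"
        by (rule sum.cong) (auto simp: integral_cos_mult_cos_half_period)
      also have "\<dots> = b k * (if k = 0 then 1/2 else 1/4)"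
        using that by (subst sum.delta') auto
      also have "\<dots> = cos_coeff h k / 2" by (auto simp: b_def)
      finally show ?thesis .
    qed
    have "I \<longlonglongrightarrow> cos_coeff h k / 2"
      by (rule tendsto_eventually) (use In in \<open>auto intro: eventually_at_top_linorderI[of "Suc k"]\<close>)
    with IJ have "J = cos_coeff h k / 2" by (rule LIMSEQ_unique)
    then show ?thesis using J by (simp add: integral_unique)
  qed
  have "h x - s x = 0"
  proof (rule zero_of_cos_moments_zero[OF _ _ x])
    show "continuous_on {0..1/2} (\<lambda>x. h x - s x)" by (intro continuous_intros h cs)
    fix k
    have "integral {0..1/2} (\<lambda>x. h x * cos (2 * pi * real k * x) - s x * cos (2 * pi * real k * x)) = 0"
      by (subst integral_diff)
         (auto intro!: integrable_continuous_real continuous_intros h cs simp: coeff, simp add: cos_coeff_def)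
    then show "integral {0..1/2} (\<lambda>x. (h x - s x) * cos (2 * pi * real k * x)) = 0"
      by (simp add: algebra_simps)
  qed
  then show ?thesis using sum[of x] by simp
qed



section \<open>Fourier coefficients of the Gaussian factors\<close>

text \<open>The real part of the characteristic function of the standard normal distribution, with
  the normalising factor cleared.\<close>

lemma gaussian_cos_has_bochner_integral:
  "has_bochner_integral lborel (\<lambda>x. exp (- x\<^sup>2 / 2) * cos (t * x)) (sqrt (2 * pi) * exp (- t\<^sup>2 / 2))"
proof -
  let ?M = std_normal_distribution
  interpret real_distribution ?M by (rule real_dist_normal_dist)
  have "(LINT x|?M. cos (t * x)) = Re (CLINT x|?M. iexp (t * x))"
    by (subst integral_Re[symmetric]) (auto intro!: integrable_iexp simp: Re_exp)
  also have "(CLINT x|?M. iexp (t * x)) = complex_of_real (exp (- t\<^sup>2 / 2))"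
    using char_std_normal_distribution by (simp add: char_def fun_eq_iff)
  finally have "(LINT x|lborel. std_normal_density x * cos (t * x)) = exp (- t\<^sup>2 / 2)"
    by (subst (asm) integral_density) auto
  moreover have "integrable lborel (\<lambda>x. std_normal_density x * cos (t * x))"
    by (rule Bochner_Integration.integrable_bound[OF integrable_std_normal_moment[of 0]])
       (auto intro!: AE_I2 simp: abs_mult mult_left_le)
  ultimately have "has_bochner_integral lborel
      (\<lambda>x. sqrt (2 * pi) * (std_normal_density x * cos (t * x))) (sqrt (2 * pi) * exp (- t\<^sup>2 / 2))"
    by (intro has_bochner_integral_mult_right) (simp add: has_bochner_integral_iff)
  then show ?thesis by (simp add: std_normal_density_def)
qed

text \<open>Rescaling by l and halving by evenness. The result is phrased as a limit of proper
  integrals because \<open>cos_coeff_bound\<close> compares integrals over [0, N] with those over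
  [1/2, N].\<close>

lemma gaussian_cos_integral_tendsto:
  fixes l \<omega> :: real
  assumes l: "l > 0"
  shows "((\<lambda>R. integral {0..R} (\<lambda>x. exp (- (x\<^sup>2 / (2 * l\<^sup>2))) * cos (\<omega> * x)))
    \<longlongrightarrow> l * sqrt (2 * pi) / 2 * exp (- (l\<^sup>2 * \<omega>\<^sup>2 / 2))) at_top"
proof -
  let ?f = "\<lambda>x. exp (- (x\<^sup>2 / (2 * l\<^sup>2))) * cos (\<omega> * x)"
  let ?I = "l * sqrt (2 * pi) * exp (- (l\<^sup>2 * \<omega>\<^sup>2 / 2))"
  have f: "has_bochner_integral lborel ?f ?I"
    using gaussian_cos_has_bochner_integral[of "l * \<omega>"] l
    by (subst (asm) lborel_has_bochner_integral_real_affine_iff[where c="1/l" and t=0])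
       (simp_all add: power_mult_distrib power_divide field_simps)
  then have int: "integrable lborel (\<lambda>x. indicator {0..} x *\<^sub>R ?f x)"
    by (intro integrable_mult_indicator) (auto simp: has_bochner_integral_iff)
  define y where "y = (LINT x|lborel. indicator {0..} x *\<^sub>R ?f x)"
  have "has_bochner_integral lborel ?f (2 *\<^sub>R y)"
    by (rule has_bochner_integral_even_function) (use int in \<open>auto simp: y_def has_bochner_integral_iff\<close>)
  with f have y: "y = ?I / 2"
    by (auto dest: has_bochner_integral_eq)
  have "(LINT x|lborel. indicator {..R} x *\<^sub>R (indicator {0..} x *\<^sub>R ?f x)) = integral {0..R} ?f" for R
  proof -
    have "set_integrable lborel {0..R} ?f"
      by (intro borel_integrable_atLeastAtMost' continuous_intros) (use l in auto)
    then have "(LINT x:{0..R}|lborel. ?f x) = integral {0..R} ?f"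
      by (rule set_borel_integral_eq_integral)
    moreover have "indicator {..R} x *\<^sub>R (indicator {0..} x *\<^sub>R ?f x) = indicator {0..R} x *\<^sub>R ?f x" for x
      by (auto split: split_indicator)
    ultimately show ?thesis by (simp only: set_lebesgue_integral_def)
  qed
  then have "((\<lambda>R. integral {0..R} ?f) \<longlongrightarrow> y) at_top"
    using tendsto_integral_at_top[OF _ int] by (simp add: y_def)
  then show ?thesis unfolding y by simp
qed

text \<open>Both integrations by parts happen in one application of the fundamental theorem: in the
  derivative of \<open>?F\<close> the two terms with h1 x * sin (\<omega> * x) cancel.\<close>

lemma integral_cos_by_parts_twice:
  fixes h h1 h2 :: "real \<Rightarrow> real"
  assumes h1: "\<And>x. (h has_real_derivative h1 x) (at x)"
    and h2: "\<And>x. (h1 has_real_derivative h2 x) (at x)"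
    and c2: "continuous_on UNIV h2" and \<omega>: "\<omega> \<noteq> 0" and ab: "a \<le> b"
  shows "integral {a..b} (\<lambda>x. h x * cos (\<omega> * x)) =
    (h b * sin (\<omega> * b) - h a * sin (\<omega> * a)) / \<omega> + (h1 b * cos (\<omega> * b) - h1 a * cos (\<omega> * a)) / \<omega>\<^sup>2
    - integral {a..b} (\<lambda>x. h2 x * cos (\<omega> * x)) / \<omega>\<^sup>2"
proof -
  let ?F = "\<lambda>x. h x * sin (\<omega> * x) / \<omega> + h1 x * cos (\<omega> * x) / \<omega>\<^sup>2"
  have "((\<lambda>x. h x * cos (\<omega> * x) + h2 x * cos (\<omega> * x) / \<omega>\<^sup>2) has_integral ?F b - ?F a) {a..b}"
  proof (rule fundamental_theorem_of_calculus[OF ab])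
    fix x
    have "(?F has_real_derivative h x * cos (\<omega> * x) + h2 x * cos (\<omega> * x) / \<omega>\<^sup>2) (at x within {a..b})"
      using \<omega> by (auto intro!: derivative_eq_intros DERIV_subset[OF h1] DERIV_subset[OF h2]
        simp: field_simps power2_eq_square)
    then show "(?F has_vector_derivative h x * cos (\<omega> * x) + h2 x * cos (\<omega> * x) / \<omega>\<^sup>2) (at x within {a..b})"
      by (simp flip: has_real_derivative_iff_has_vector_derivative)
  qed
  moreover have "(\<lambda>x. h2 x * cos (\<omega> * x)) integrable_on {a..b}"
    by (intro integrable_continuous_real continuous_intros continuous_on_subset[OF c2]) auto
  ultimately have "((\<lambda>x. h x * cos (\<omega> * x) + h2 x * cos (\<omega> * x) / \<omega>\<^sup>2 - h2 x * cos (\<omega> * x) / \<omega>\<^sup>2) has_integral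
      ?F b - ?F a - integral {a..b} (\<lambda>x. h2 x * cos (\<omega> * x)) / \<omega>\<^sup>2) {a..b}"
    by (intro has_integral_diff has_integral_divide) (auto simp: has_integral_integral)
  then show ?thesis by (simp add: integral_unique diff_divide_distrib)
qed

text \<open>Total variation on an interval of monotonicity. It is applied with a first derivative as
  h, between sign changes of the second derivative.\<close>

lemma integral_abs_deriv_nonneg:
  fixes h h' :: "real \<Rightarrow> real"
  assumes "\<And>x. (h has_real_derivative h' x) (at x)" "a \<le> b" "\<And>x. a \<le> x \<Longrightarrow> x \<le> b \<Longrightarrow> h' x \<ge> 0"
  shows "integral {a..b} (\<lambda>x. \<bar>h' x\<bar>) = h b - h a"
proof -
  have "(h' has_integral h b - h a) {a..b}"
    using assms(1,2) by (intro fundamental_theorem_of_calculus)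
      (auto intro: DERIV_subset simp flip: has_real_derivative_iff_has_vector_derivative)
  moreover have "integral {a..b} (\<lambda>x. \<bar>h' x\<bar>) = integral {a..b} h'"
    by (rule integral_cong) (use assms(3) in auto)
  ultimately show ?thesis by (simp add: integral_unique)
qed

lemma integral_abs_deriv_nonpos:
  fixes h h' :: "real \<Rightarrow> real"
  assumes "\<And>x. (h has_real_derivative h' x) (at x)" "a \<le> b" "\<And>x. a \<le> x \<Longrightarrow> x \<le> b \<Longrightarrow> h' x \<le> 0"
  shows "integral {a..b} (\<lambda>x. \<bar>h' x\<bar>) = h a - h b"
  using integral_abs_deriv_nonneg[of "\<lambda>x. - h x" "\<lambda>x. - h' x" a b] assms
  by (simp add: DERIV_minus)

text \<open>The boundary terms containing the sine vanish because both 1/2 and N are zeros of it.\<close>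
lemma cos_coeff_bound:
  fixes h h1 h2 :: "real \<Rightarrow> real"
  assumes h1: "\<And>x. (h has_real_derivative h1 x) (at x)"
    and h2: "\<And>x. (h1 has_real_derivative h2 x) (at x)"
    and c2: "continuous_on UNIV h2" and k: "k > 0"
    and lim: "(\<lambda>N. integral {0..real N} (\<lambda>x. h x * cos (2 * pi * real k * x))) \<longlonglongrightarrow> L"
    and V: "\<forall>\<^sub>F N in sequentially.
      \<bar>h1 (1/2)\<bar> + \<bar>h1 (real N)\<bar> + integral {1/2..real N} (\<lambda>x. \<bar>h2 x\<bar>) \<le> V"
  shows "\<bar>cos_coeff h k\<bar> \<le> 2 * \<bar>L\<bar> + V / (2 * pi\<^sup>2 * (real k)\<^sup>2)"
proof -
  define \<omega> where "\<omega> = 2 * pi * real k"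
  have \<omega>: "\<omega> > 0" using k by (simp add: \<omega>_def)
  let ?I = "\<lambda>N. integral {0..real N} (\<lambda>x. h x * cos (\<omega> * x))"
  have ch: "continuous_on A h" for A
    by (rule DERIV_continuous_on) (rule DERIV_subset[OF h1 subset_UNIV])
  have "\<forall>\<^sub>F N in sequentially. \<bar>cos_coeff h k\<bar> \<le> 2 * \<bar>?I N\<bar> + 2 * V / \<omega>\<^sup>2"
    using V eventually_ge_at_top[of 1]
  proof eventually_elim
    case (elim N)
    let ?T = "integral {1/2..real N} (\<lambda>x. h x * cos (\<omega> * x))"
    have s1: "sin (\<omega> * (1/2)) = 0" using sin_npi[of k] by (simp add: \<omega>_def mult.commute)
    have s2: "sin (\<omega> * real N) = 0" using sin_npi[of "2 * k * N"] by (simp add: \<omega>_def mult_ac)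
    have ci: "(\<lambda>x. h2 x * cos (\<omega> * x)) integrable_on {1/2..real N}"
      by (intro integrable_continuous_real continuous_intros continuous_on_subset[OF c2]) auto
    have ai: "(\<lambda>x. \<bar>h2 x\<bar>) integrable_on {1/2..real N}"
      by (intro integrable_continuous_real continuous_intros continuous_on_subset[OF c2]) auto
    have "norm (integral {1/2..real N} (\<lambda>x. h2 x * cos (\<omega> * x))) \<le> integral {1/2..real N} (\<lambda>x. \<bar>h2 x\<bar>)"
      by (rule integral_norm_bound_integral[OF ci ai]) (simp add: abs_mult mult_left_le)
    moreover have "\<bar>h1 (real N) * cos (\<omega> * real N)\<bar> \<le> \<bar>h1 (real N)\<bar>" "\<bar>h1 (1/2) * cos (\<omega> * (1/2))\<bar> \<le> \<bar>h1 (1/2)\<bar>"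
      by (simp_all add: abs_mult mult_left_le)
    moreover have "?T = (h1 (real N) * cos (\<omega> * real N) - h1 (1/2) * cos (\<omega> * (1/2))
        - integral {1/2..real N} (\<lambda>x. h2 x * cos (\<omega> * x))) / \<omega>\<^sup>2"
      using elim(2) \<omega> s1 s2
      by (subst integral_cos_by_parts_twice[OF h1 h2 c2]) (auto simp: diff_divide_distrib)
    ultimately have T: "\<bar>?T\<bar> \<le> V / \<omega>\<^sup>2"
      using elim(1) \<omega> by (auto simp: abs_divide intro!: divide_right_mono)
    have "integral {0..1/2} (\<lambda>x. h x * cos (\<omega> * x)) + ?T = ?I N"
      using elim(2)
      by (intro Henstock_Kurzweil_Integration.integral_combine)
         (auto intro!: integrable_continuous_real continuous_intros ch)
    moreover have "cos_coeff h k = 2 * integral {0..1/2} (\<lambda>x. h x * cos (\<omega> * x))"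
      by (simp add: cos_coeff_def \<omega>_def)
    ultimately have "\<bar>cos_coeff h k\<bar> \<le> 2 * \<bar>?I N\<bar> + 2 * \<bar>?T\<bar>" by linarith
    then show ?case using T by simp
  qed
  moreover have "(\<lambda>N. 2 * \<bar>?I N\<bar> + 2 * V / \<omega>\<^sup>2) \<longlonglongrightarrow> 2 * \<bar>L\<bar> + 2 * V / \<omega>\<^sup>2"
    using lim by (auto intro!: tendsto_intros simp: \<omega>_def)
  ultimately have "\<bar>cos_coeff h k\<bar> \<le> 2 * \<bar>L\<bar> + 2 * V / \<omega>\<^sup>2"
    by (intro tendsto_lowerbound) auto
  moreover have "2 * V / \<omega>\<^sup>2 = V / (2 * pi\<^sup>2 * (real k)\<^sup>2)"
    by (simp add: \<omega>_def power_mult_distrib field_simps)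
  ultimately show ?thesis by simp
qed



section \<open>The one-dimensional factors g (\<open>gauss\<close>) and f (\<open>dgauss\<close>)
  and the variation of their first derivatives\<close>

definition gauss :: "real \<Rightarrow> real \<Rightarrow> real" where
  "gauss l x = exp (- (x\<^sup>2 / (2 * l\<^sup>2)))"

definition gauss_deriv :: "real \<Rightarrow> real \<Rightarrow> real" where
  "gauss_deriv l x = - (x / l\<^sup>2) * gauss l x"

definition gauss_deriv2 :: "real \<Rightarrow> real \<Rightarrow> real" where
  "gauss_deriv2 l x = (x\<^sup>2 / l\<^sup>2 - 1) / l\<^sup>2 * gauss l x"

definition dgauss :: "real \<Rightarrow> real \<Rightarrow> real" where
  "dgauss l x = x\<^sup>2 / (2 * l\<^sup>2) * gauss l x"

definition dgauss_deriv :: "real \<Rightarrow> real \<Rightarrow> real" where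
  "dgauss_deriv l x = x / l\<^sup>2 * (1 - x\<^sup>2 / (2 * l\<^sup>2)) * gauss l x"

definition dgauss_deriv2 :: "real \<Rightarrow> real \<Rightarrow> real" where
  "dgauss_deriv2 l x = (1 - 5 * (x\<^sup>2 / (2 * l\<^sup>2)) + 2 * (x\<^sup>2 / (2 * l\<^sup>2))\<^sup>2) / l\<^sup>2 * gauss l x"

lemma gauss_pos [simp]: "gauss l x > 0"
  by (simp add: gauss_def)

lemma gauss_has_deriv:
  assumes "l > 0"
  shows "(gauss l has_real_derivative gauss_deriv l x) (at x)"
  unfolding gauss_def [abs_def] gauss_deriv_def
  by (rule derivative_eq_intros refl | use assms in \<open>simp add: field_simps power2_eq_square\<close>)+

lemma gauss_deriv_has_deriv:
  assumes "l > 0"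
  shows "(gauss_deriv l has_real_derivative gauss_deriv2 l x) (at x)"
  unfolding gauss_deriv_def [abs_def] gauss_deriv2_def
  by (rule derivative_eq_intros gauss_has_deriv refl assms
      | use assms in \<open>simp add: gauss_deriv_def field_simps power2_eq_square\<close>)+

lemma dgauss_has_deriv:
  assumes "l > 0"
  shows "(dgauss l has_real_derivative dgauss_deriv l x) (at x)"
  unfolding dgauss_def [abs_def] dgauss_deriv_def
  by (rule derivative_eq_intros gauss_has_deriv refl assms
      | use assms in \<open>simp add: gauss_deriv_def field_simps power2_eq_square\<close>)+

lemma dgauss_deriv_has_deriv:
  assumes "l > 0"
  shows "(dgauss_deriv l has_real_derivative dgauss_deriv2 l x) (at x)"
  unfolding dgauss_deriv_def [abs_def] dgauss_deriv2_def
  by (rule derivative_eq_intros gauss_has_deriv refl assms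
      | use assms in \<open>simp add: gauss_deriv_def field_simps power2_eq_square\<close>)+

lemma continuous_on_gauss: "l > 0 \<Longrightarrow> continuous_on A (gauss l)"
  unfolding gauss_def [abs_def] by (intro continuous_intros) auto

lemma continuous_on_dgauss: "l > 0 \<Longrightarrow> continuous_on A (dgauss l)"
  unfolding dgauss_def [abs_def] by (intro continuous_intros continuous_on_gauss) auto

lemma continuous_on_gauss_deriv2: "l > 0 \<Longrightarrow> continuous_on A (gauss_deriv2 l)"
  unfolding gauss_deriv2_def [abs_def] by (intro continuous_intros continuous_on_gauss) auto

lemma continuous_on_dgauss_deriv2: "l > 0 \<Longrightarrow> continuous_on A (dgauss_deriv2 l)"
  unfolding dgauss_deriv2_def [abs_def] by (intro continuous_intros continuous_on_gauss) auto

lemma integral_abs_combine: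
  fixes f :: "real \<Rightarrow> real"
  assumes "continuous_on UNIV f" "a \<le> c" "c \<le> b"
  shows "integral {a..b} (\<lambda>x. \<bar>f x\<bar>) = integral {a..c} (\<lambda>x. \<bar>f x\<bar>) + integral {c..b} (\<lambda>x. \<bar>f x\<bar>)"
  using assms(2,3)
  by (intro Henstock_Kurzweil_Integration.integral_combine[symmetric] integrable_continuous_real
        continuous_intros continuous_on_subset[OF assms(1)]) auto

lemma gauss_deriv2_nonneg: "l > 0 \<Longrightarrow> l \<le> x \<Longrightarrow> gauss_deriv2 l x \<ge> 0"
  by (auto simp: gauss_deriv2_def intro!: mult_nonneg_nonneg divide_nonneg_nonneg power_mono less_imp_le[OF gauss_pos])

lemma gauss_deriv2_nonpos: "l > 0 \<Longrightarrow> 0 \<le> x \<Longrightarrow> x \<le> l \<Longrightarrow> gauss_deriv2 l x \<le> 0"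
  by (auto simp: gauss_deriv2_def intro!: mult_nonpos_nonneg divide_nonpos_nonneg power_mono less_imp_le[OF gauss_pos])

lemma abs_gauss_deriv: "x \<ge> 0 \<Longrightarrow> \<bar>gauss_deriv l x\<bar> = - gauss_deriv l x"
  by (auto simp: gauss_deriv_def abs_mult less_imp_le[OF gauss_pos])

text \<open>The numerators of the case distinctions in the error terms. They bound l^2 times the total variation
  of the first derivative on [1/2, oo) plus its modulus at 1/2.\<close>
definition gauss_tail :: "real \<Rightarrow> real" where
  "gauss_tail l = (if l < 1/2 then exp (- (1 / (8 * l\<^sup>2))) else 2 * l * exp (- (1/2)))"

definition dgauss_tail :: "real \<Rightarrow> real" where
  "dgauss_tail l = (if l \<le> 1/2 * sqrt (2 / (5 + sqrt 17)) then exp (- (1 / (8 * l\<^sup>2))) / (8 * l\<^sup>2)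
    else 1 + 3 * l / 2)"

text \<open>On x \<ge> 0 the first derivative is nonpositive, falls until the inflection point x = l
  and rises afterwards. If l < 1/2, only the rising part lies in [1/2, N], and the left side
  telescopes to -2 times the derivative at 1/2. Otherwise it telescopes to -2 times the minimum,
  which is the value at l. In both cases N drops out and the bound is an equality.\<close>

lemma gauss_deriv_variation:
  assumes l: "l > 0"
  shows "\<forall>\<^sub>F N in sequentially. \<bar>gauss_deriv l (1/2)\<bar> + \<bar>gauss_deriv l (real N)\<bar> +
    integral {1/2..real N} (\<lambda>x. \<bar>gauss_deriv2 l x\<bar>) \<le> gauss_tail l / l\<^sup>2"
proof (cases "l < 1/2")
  case True
  have eq: "- 2 * gauss_deriv l (1/2) = gauss_tail l / l\<^sup>2"
    using True l by (simp add: gauss_deriv_def gauss_def gauss_tail_def power2_eq_square)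
  show ?thesis
    using eventually_ge_at_top[of 1]
  proof eventually_elim
    case (elim N)
    have "integral {1/2..real N} (\<lambda>x. \<bar>gauss_deriv2 l x\<bar>) = gauss_deriv l (real N) - gauss_deriv l (1/2)"
      by (rule integral_abs_deriv_nonneg[OF gauss_deriv_has_deriv[OF l]])
         (use True l elim in \<open>auto intro!: gauss_deriv2_nonneg\<close>)
    then show ?case using eq by (simp add: abs_gauss_deriv)
  qed
next
  case False
  have eq: "- 2 * gauss_deriv l l = gauss_tail l / l\<^sup>2"
    using False l by (simp add: gauss_deriv_def gauss_def gauss_tail_def power2_eq_square)
  show ?thesis
    using eventually_ge_at_top[of "nat \<lceil>l\<rceil>"]
  proof eventually_elim
    case (elim N)
    then have N: "l \<le> real N" by linarith
    have "integral {1/2..l} (\<lambda>x. \<bar>gauss_deriv2 l x\<bar>) = gauss_deriv l (1/2) - gauss_deriv l l"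
      by (rule integral_abs_deriv_nonpos[OF gauss_deriv_has_deriv[OF l]])
         (use False l N in \<open>auto intro!: gauss_deriv2_nonpos\<close>)
    moreover have "integral {l..real N} (\<lambda>x. \<bar>gauss_deriv2 l x\<bar>) = gauss_deriv l (real N) - gauss_deriv l l"
      by (rule integral_abs_deriv_nonneg[OF gauss_deriv_has_deriv[OF l]])
         (use l N in \<open>auto intro!: gauss_deriv2_nonneg\<close>)
    moreover have "integral {1/2..real N} (\<lambda>x. \<bar>gauss_deriv2 l x\<bar>) =
        integral {1/2..l} (\<lambda>x. \<bar>gauss_deriv2 l x\<bar>) + integral {l..real N} (\<lambda>x. \<bar>gauss_deriv2 l x\<bar>)"
      by (rule integral_abs_combine) (use False N in \<open>auto intro: continuous_on_gauss_deriv2 l\<close>)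
    ultimately show ?case using eq by (simp add: abs_gauss_deriv)
  qed
qed

text \<open>In u = x^2 / (2 * l^2) the polynomial factor is 1 - 5 u + 2 u^2 with roots (5 - sqrt 17)
  / 4 and (5 + sqrt 17) / 4. This is where sqrt 17 enters: the threshold for l in
  \<open>dgauss_tail\<close> says exactly that the larger inflection point of f is at most
  1/2.\<close>

lemma dgauss_deriv2_factor:
  "dgauss_deriv2 l x = 2 * gauss l x / l\<^sup>2 *
    ((x\<^sup>2 / (2 * l\<^sup>2) - (5 - sqrt 17) / 4) * (x\<^sup>2 / (2 * l\<^sup>2) - (5 + sqrt 17) / 4))"
proof -
  have "1 - 5 * u + 2 * u\<^sup>2 = 2 * ((u - (5 - sqrt 17) / 4) * (u - (5 + sqrt 17) / 4))" for u :: real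
  proof -
    have "sqrt 17 * sqrt 17 = (17::real)" by simp
    then show ?thesis by (simp add: power2_eq_square field_simps)
  qed
  then have "dgauss_deriv2 l x =
    2 * ((x\<^sup>2 / (2 * l\<^sup>2) - (5 - sqrt 17) / 4) * (x\<^sup>2 / (2 * l\<^sup>2) - (5 + sqrt 17) / 4)) / l\<^sup>2 * gauss l x"
    unfolding dgauss_deriv2_def by (simp only:)
  then show ?thesis by simp
qed

lemma sqrt_17_bounds: "4 < sqrt (17::real)" "sqrt (17::real) < 21/5"
  by (rule real_less_rsqrt, simp add: power2_eq_square)
     (rule real_less_lsqrt, simp_all add: power2_eq_square)

text \<open>By \<open>dgauss_deriv_eq_scaled\<close> the left side is l times the derivative of f at
  l * s. The constants 43/100 here and 8/25 in \<open>neg_scaled_dgauss_deriv_le\<close> add up to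
  3/4: twice their sum has to fit into the coefficient 3/2 of l in
  \<open>dgauss_tail\<close>.\<close>

lemma scaled_dgauss_deriv_le:
  fixes s :: real
  assumes "s \<ge> 0"
  shows "s * (1 - s\<^sup>2 / 2) * exp (- (s\<^sup>2 / 2)) \<le> 43/100"
proof (cases "s\<^sup>2 / 2 \<le> 1")
  case True
  \<comment> \<open>the maximum is attained close to s = 0.687\<close>
  have "0 \<le> (s - 687/1000)\<^sup>2 * (s + 1804/1000)"
    using assms by simp
  \<comment> \<open>The second factor is chosen so that the coefficient of s * s is exactly 43/100.
    The linear and the constant coefficient leave a margin in the direction required.\<close>
  also have "\<dots> = s * s * s + 43/100 * (s * s) - 2006727/1000000 * s + 851432076/1000000000"
    by (simp add: power2_eq_square field_simps)
  finally have "2 * s - s * s * s \<le> 43/100 * (2 + s * s)"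
    using assms by (simp add: field_simps)
  then have "s * (2 - s\<^sup>2) \<le> 43/100 * (2 + s\<^sup>2)"
    by (simp add: power2_eq_square algebra_simps)
  then have "s * (1 - s\<^sup>2 / 2) \<le> 43/100 * (1 + s\<^sup>2 / 2)"
    by (simp add: field_simps)
  also have "\<dots> \<le> 43/100 * exp (s\<^sup>2 / 2)"
    by (intro mult_left_mono exp_ge_add_one_self) auto
  finally show ?thesis by (simp add: exp_minus field_simps)
next
  case False
  then have "s * (1 - s\<^sup>2 / 2) * exp (- (s\<^sup>2 / 2)) \<le> 0"
    using assms by (intro mult_nonpos_nonneg mult_nonneg_nonpos) auto
  then show ?thesis by simp
qed

lemma exp_1_gt: "exp (1::real) > 27/10"
  using exp_lower_Taylor_quadratic[of "1::real"] e_approx_32 by (auto simp: abs_if split: if_splits)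

lemma exp_2_gt: "exp (2::real) > 7"
proof -
  have "(27/10::real)\<^sup>2 < (exp 1)\<^sup>2" by (intro power_strict_mono exp_1_gt) auto
  also have "(exp 1)\<^sup>2 = exp (2::real)" by (simp flip: exp_double)
  finally show ?thesis by (simp add: power2_eq_square)
qed

text \<open>Here s is the scaled larger inflection point, where the derivative of f has its minimum.
  As u = s^2 / 2 is slightly above 2, the tangent of exp at 2 is sharp enough: u - 1 \<le> exp (u -
  2) gives (u - 1) * exp (- u) \<le> exp (- 2) < 1/7.\<close>

lemma neg_scaled_dgauss_deriv_le:
  fixes s :: real
  assumes s: "s\<^sup>2 / 2 = (5 + sqrt 17) / 4" and pos: "s \<ge> 0"
  shows "s * (s\<^sup>2 / 2 - 1) * exp (- (s\<^sup>2 / 2)) \<le> 8/25"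
proof -
  define u where "u = s\<^sup>2 / 2"
  have u: "2 < u" "u < 121/50" using sqrt_17_bounds by (auto simp: u_def s)
  then have "s\<^sup>2 < (11/5)\<^sup>2" by (simp add: u_def power2_eq_square)
  then have s_le: "s < 11/5" by (rule power2_less_imp_less) simp
  have "(u - 1) * 7 \<le> exp (u - 2) * exp 2"
    using u exp_ge_add_one_self[of "u - 2"] exp_2_gt by (intro mult_mono) auto
  also have "\<dots> = exp u" by (simp flip: exp_add)
  finally have "(u - 1) * exp (- u) \<le> 1/7"
    by (simp add: exp_minus field_simps)
  then have "s * ((u - 1) * exp (- u)) \<le> 11/5 * (1/7)"
    using s_le pos u by (intro mult_mono) auto
  then show ?thesis by (simp add: u_def mult.assoc)
qed

lemma dgauss_deriv_eq_scaled:
  assumes "l > 0"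
  shows "dgauss_deriv l (l * s) = (s * (1 - s\<^sup>2 / 2) * exp (- (s\<^sup>2 / 2))) / l"
  using assms by (simp add: dgauss_deriv_def gauss_def power_mult_distrib power2_eq_square)

lemma dgauss_tail_ge:
  assumes l: "l > 0" "\<not> l \<le> 1/2 * sqrt (2 / (5 + sqrt 17))"
  shows "3 / (2 * l) \<le> dgauss_tail l / l\<^sup>2"
  using l by (simp add: dgauss_tail_def field_simps power2_eq_square)

text \<open>On x \<ge> 0 the derivative of f rises from 0 to a maximum at l * p, falls to a negative
  minimum at l * q and then rises while staying nonpositive. If l * q \<le> 1/2, the left side
  telescopes to -2 times the value at 1/2. Otherwise 1/2 may lie on either side of l * p. Extending
  the variation to [0, N] avoids this distinction and yields twice the difference of maximum and
  minimum.\<close>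

lemma dgauss_deriv_variation:
  assumes l: "l > 0"
  shows "\<forall>\<^sub>F N in sequentially. \<bar>dgauss_deriv l (1/2)\<bar> + \<bar>dgauss_deriv l (real N)\<bar> +
    integral {1/2..real N} (\<lambda>x. \<bar>dgauss_deriv2 l x\<bar>) \<le> dgauss_tail l / l\<^sup>2"
proof -
  define p where "p = sqrt ((5 - sqrt 17) / 2)"
  define q where "q = sqrt ((5 + sqrt 17) / 2)"
  have p2: "p\<^sup>2 / 2 = (5 - sqrt 17) / 4" and q2: "q\<^sup>2 / 2 = (5 + sqrt 17) / 4"
    using sqrt_17_bounds by (simp_all add: p_def q_def)
  have pq: "0 \<le> p" "p \<le> q" "1 \<le> q"
    using sqrt_17_bounds by (simp_all add: p_def q_def)
  have q0: "0 \<le> q" using pq by simp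
  have mono: "x\<^sup>2 / (2 * l\<^sup>2) \<le> y\<^sup>2 / 2" if "0 \<le> x" "x \<le> l * y" for x y
    using power_mono[OF that(2,1), of 2] l by (simp add: field_simps power_mult_distrib)
  have mono': "y\<^sup>2 / 2 \<le> x\<^sup>2 / (2 * l\<^sup>2)" if "0 \<le> y" "l * y \<le> x" for x y
    using power_mono[OF that(2), of 2] that(1) l by (simp add: field_simps power_mult_distrib)
  have pos: "0 \<le> 2 * gauss l x / l\<^sup>2" for x by (simp add: less_imp_le)
  have sgn1: "dgauss_deriv2 l x \<ge> 0" if "0 \<le> x" "x \<le> l * p" for x
    unfolding dgauss_deriv2_factor
    by (rule mult_nonneg_nonneg[OF pos], rule mult_nonpos_nonpos) (use mono[OF that] p2 sqrt_17_bounds in auto)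
  have sgn2: "dgauss_deriv2 l x \<le> 0" if "l * p \<le> x" "x \<le> l * q" for x
  proof -
    have "0 \<le> l * p" using l pq by simp
    then have "0 \<le> x" using that by linarith
    have u1: "0 \<le> x\<^sup>2 / (2 * l\<^sup>2) - (5 - sqrt 17) / 4" using mono'[OF pq(1) that(1)] p2 by linarith
    have u2: "x\<^sup>2 / (2 * l\<^sup>2) - (5 + sqrt 17) / 4 \<le> 0" using mono[OF \<open>0 \<le> x\<close> that(2)] q2 by linarith
    show ?thesis
      unfolding dgauss_deriv2_factor
      by (rule mult_nonneg_nonpos[OF pos mult_nonneg_nonpos[OF u1 u2]])
  qed
  have sgn3: "dgauss_deriv2 l x \<ge> 0" if "l * q \<le> x" for x
  proof -
    have u2: "0 \<le> x\<^sup>2 / (2 * l\<^sup>2) - (5 + sqrt 17) / 4" using mono'[OF q0 that] q2 by linarith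
    show ?thesis
      unfolding dgauss_deriv2_factor
      by (intro mult_nonneg_nonneg[OF pos mult_nonneg_nonneg[OF _ u2]]) (rule order_trans[OF u2], simp)
  qed
  have neg: "dgauss_deriv l x \<le> 0" if "l * q \<le> x" for x
  proof -
    have "0 \<le> l * q" using l pq by simp
    then have x: "0 \<le> x / l\<^sup>2" using that by simp
    have "1 \<le> q\<^sup>2 / 2" unfolding q2 using sqrt_17_bounds by simp
    also have "\<dots> \<le> x\<^sup>2 / (2 * l\<^sup>2)" by (rule mono'[OF q0 that])
    finally have "1 - x\<^sup>2 / (2 * l\<^sup>2) \<le> 0" by simp
    then show ?thesis
      unfolding dgauss_deriv_def
      by (rule mult_nonpos_nonneg[OF mult_nonneg_nonpos[OF x] less_imp_le[OF gauss_pos]])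
  qed
  note up = integral_abs_deriv_nonneg[OF dgauss_deriv_has_deriv[OF l]]
  note down = integral_abs_deriv_nonpos[OF dgauss_deriv_has_deriv[OF l]]
  note comb = integral_abs_combine[OF continuous_on_dgauss_deriv2[OF l]]
  have ev: "\<forall>\<^sub>F N in sequentially. l * q \<le> real N \<and> 1 \<le> N"
    by (intro eventually_conj eventually_ge_at_top[of 1]
        eventually_at_top_linorderI[of "nat \<lceil>l * q\<rceil>"]) linarith
  show ?thesis
  proof (cases "l \<le> 1/2 * sqrt (2 / (5 + sqrt 17))")
    case True
    have "q * sqrt (2 / (5 + sqrt 17)) = 1"
      using sqrt_17_bounds unfolding q_def by (subst real_sqrt_mult[symmetric]) simp
    then have lq: "l * q \<le> 1/2"
      using mult_left_mono[OF True, of q] pq by (simp add: mult.commute)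
    have "- 2 * dgauss_deriv l (1/2) = (1 / (8 * l\<^sup>2) - 1) / l\<^sup>2 * exp (- (1 / (8 * l\<^sup>2)))"
      using l by (simp add: dgauss_deriv_def gauss_def power_divide divide_simps) (simp add: algebra_simps)
    also have "\<dots> \<le> 1 / (8 * l\<^sup>2) / l\<^sup>2 * exp (- (1 / (8 * l\<^sup>2)))"
      by (intro mult_right_mono divide_right_mono) auto
    also have "\<dots> = dgauss_tail l / l\<^sup>2"
      using True by (simp add: dgauss_tail_def)
    finally have V: "- 2 * dgauss_deriv l (1/2) \<le> dgauss_tail l / l\<^sup>2" .
    show ?thesis using ev
    proof eventually_elim
      case (elim N)
      have "integral {1/2..real N} (\<lambda>x. \<bar>dgauss_deriv2 l x\<bar>) = dgauss_deriv l (real N) - dgauss_deriv l (1/2)"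
        by (rule up) (use lq elim in \<open>auto intro!: sgn3\<close>)
      then show ?case using V neg[of "1/2"] neg[of "real N"] elim lq by linarith
    qed
  next
    case False
    \<comment> \<open>the derivative vanishes at 0, so the variation over [0, 1/2] pays for its value at 1/2\<close>
    have "2 * dgauss_deriv l (l * p) - 2 * dgauss_deriv l (l * q) \<le> 3 / (2 * l)"
    proof -
      have "dgauss_deriv l (l * p) \<le> (43/100) / l"
        unfolding dgauss_deriv_eq_scaled[OF l]
        by (rule divide_right_mono[OF scaled_dgauss_deriv_le]) (use pq l in auto)
      moreover have "- dgauss_deriv l (l * q) = (q * (q\<^sup>2 / 2 - 1) * exp (- (q\<^sup>2 / 2))) / l"
        unfolding dgauss_deriv_eq_scaled[OF l] by (simp add: algebra_simps diff_divide_distrib)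
      moreover have "\<dots> \<le> (8/25) / l"
        by (rule divide_right_mono[OF neg_scaled_dgauss_deriv_le]) (use pq q2 l in auto)
      moreover have "2 * ((43/100) / l) + 2 * ((8/25) / l) = 3 / (2 * l)"
        by (simp add: field_simps)
      ultimately show ?thesis by linarith
    qed
    with dgauss_tail_ge[OF l False]
    have V: "2 * dgauss_deriv l (l * p) - 2 * dgauss_deriv l (l * q) \<le> dgauss_tail l / l\<^sup>2" by linarith
    show ?thesis using ev
    proof eventually_elim
      case (elim N)
      have lpq: "0 \<le> l * p" "l * p \<le> l * q" using l pq by (auto intro: mult_left_mono)
      have d0: "dgauss_deriv l 0 = 0" by (simp add: dgauss_deriv_def)
      have "integral {0..l * p} (\<lambda>x. \<bar>dgauss_deriv2 l x\<bar>) = dgauss_deriv l (l * p)"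
        using up[of 0 "l * p"] lpq d0 by (auto intro!: sgn1)
      moreover have "integral {l * p..l * q} (\<lambda>x. \<bar>dgauss_deriv2 l x\<bar>) = dgauss_deriv l (l * p) - dgauss_deriv l (l * q)"
        by (rule down) (use lpq in \<open>auto intro!: sgn2\<close>)
      moreover have "integral {l * q..real N} (\<lambda>x. \<bar>dgauss_deriv2 l x\<bar>) = dgauss_deriv l (real N) - dgauss_deriv l (l * q)"
        by (rule up) (use elim in \<open>auto intro!: sgn3\<close>)
      moreover have "integral {0..real N} (\<lambda>x. \<bar>dgauss_deriv2 l x\<bar>) =
          integral {0..l * p} (\<lambda>x. \<bar>dgauss_deriv2 l x\<bar>) + integral {l * p..l * q} (\<lambda>x. \<bar>dgauss_deriv2 l x\<bar>)
          + integral {l * q..real N} (\<lambda>x. \<bar>dgauss_deriv2 l x\<bar>)"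
        using comb[of 0 "l * q" "real N"] comb[of 0 "l * p" "l * q"] lpq elim by auto
      moreover have "integral {0..real N} (\<lambda>x. \<bar>dgauss_deriv2 l x\<bar>) =
          integral {0..1/2} (\<lambda>x. \<bar>dgauss_deriv2 l x\<bar>) + integral {1/2..real N} (\<lambda>x. \<bar>dgauss_deriv2 l x\<bar>)"
        by (rule comb) (use elim in auto)
      moreover have "\<bar>dgauss_deriv l (1/2)\<bar> \<le> integral {0..1/2} (\<lambda>x. \<bar>dgauss_deriv2 l x\<bar>)"
      proof -
        have "(dgauss_deriv2 l has_integral dgauss_deriv l (1/2) - dgauss_deriv l 0) {0..1/2}"
          by (intro fundamental_theorem_of_calculus)
             (auto intro: DERIV_subset[OF dgauss_deriv_has_deriv[OF l]]
               simp flip: has_real_derivative_iff_has_vector_derivative)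
        moreover have "norm (integral {0..1/2} (dgauss_deriv2 l)) \<le> integral {0..1/2} (\<lambda>x. \<bar>dgauss_deriv2 l x\<bar>)"
          by (rule integral_norm_bound_integral)
             (auto intro!: integrable_continuous_real continuous_intros continuous_on_dgauss_deriv2 l)
        ultimately show ?thesis using d0 by (simp add: integral_unique)
      qed
      ultimately show ?case using V neg[of "real N"] elim by linarith
    qed
  qed
qed



section \<open>Bounds for the cosine coefficients, and a comparison principle for their sums\<close>

lemma gamma_term_eq: "gamma_term t l = l * sqrt (2 * pi) * exp (- t\<^sup>2) + gauss_tail l / t\<^sup>2"
  by (simp add: gamma_term_def gauss_tail_def)

lemma xi_term_eq: "xi_term t l = (t\<^sup>2 + 1/2) * l * sqrt (2 * pi) * exp (- t\<^sup>2) + dgauss_tail l / t\<^sup>2"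
  by (simp add: xi_term_def dgauss_tail_def add_divide_distrib mult_ac)

lemma gauss_integral_tendsto:
  assumes l: "l > 0" and k: "k > 0"
  shows "(\<lambda>N. integral {0..real N} (\<lambda>x. gauss l x * cos (2 * pi * real k * x)))
    \<longlonglongrightarrow> l * sqrt (2 * pi) / 2 * exp (- (sqrt 2 * pi * l * real k)\<^sup>2)"
proof -
  have "(l\<^sup>2 * (2 * pi * real k)\<^sup>2 / 2) = (sqrt 2 * pi * l * real k)\<^sup>2"
    by (simp add: power_mult_distrib)
  then show ?thesis
    using filterlim_compose[OF gaussian_cos_integral_tendsto[OF l, of "2 * pi * real k"] filterlim_real_sequentially]
    by (simp add: gauss_def)
qed

text \<open>With u = N^2 / (2 * l^2) the modulus is 2 / N * (u * exp (- u)), and u * exp (- u) \<le>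
  1.\<close>

lemma gauss_deriv_tendsto_0:
  assumes l: "l > 0"
  shows "(\<lambda>N. gauss_deriv l (real N)) \<longlonglongrightarrow> 0"
proof (rule tendsto_sandwich)
  show "\<forall>\<^sub>F N in sequentially. - 2 / real N \<le> gauss_deriv l (real N)"
    using eventually_gt_at_top[of 0]
  proof eventually_elim
    case (elim N)
    let ?u = "(real N)\<^sup>2 / (2 * l\<^sup>2)"
    have "?u * exp (- ?u) \<le> 1"
      using mult_right_mono[of ?u "exp ?u" "exp (- ?u)"] exp_ge_add_one_self[of ?u]
      by (simp flip: exp_add)
    then have "2 / real N * (?u * exp (- ?u)) \<le> 2 / real N * 1"
      by (rule mult_left_mono) simp
    moreover have "2 / real N * (?u * exp (- ?u)) = - gauss_deriv l (real N)"
      using elim by (simp add: gauss_deriv_def gauss_def power2_eq_square)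
    ultimately show ?case by simp
  qed
  show "\<forall>\<^sub>F N in sequentially. gauss_deriv l (real N) \<le> 0"
    by (intro always_eventually allI) (simp add: gauss_deriv_def less_imp_le)
  show "(\<lambda>N. - 2 / real N) \<longlonglongrightarrow> 0"
    by (rule lim_const_over_n)
qed simp

text \<open>Uses dgauss = (l^2 gauss'' + gauss) / 2.\<close>
lemma dgauss_integral_tendsto:
  assumes l: "l > 0" and k: "k > 0"
  defines "t \<equiv> sqrt 2 * pi * l * real k"
  shows "(\<lambda>N. integral {0..real N} (\<lambda>x. dgauss l x * cos (2 * pi * real k * x)))
    \<longlonglongrightarrow> (1/2 - t\<^sup>2) * (l * sqrt (2 * pi) / 2 * exp (- t\<^sup>2))"
proof -
  define \<omega> where "\<omega> = 2 * pi * real k"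
  have \<omega>: "\<omega> \<noteq> 0" using k by (simp add: \<omega>_def)
  have t: "l\<^sup>2 * \<omega>\<^sup>2 = 2 * t\<^sup>2" by (simp add: t_def \<omega>_def power_mult_distrib)
  have eq: "integral {0..real N} (\<lambda>x. dgauss l x * cos (\<omega> * x)) =
      (1/2 - t\<^sup>2) * integral {0..real N} (\<lambda>x. gauss l x * cos (\<omega> * x)) + l\<^sup>2 / 2 * gauss_deriv l (real N)" for N
  proof -
    let ?g = "\<lambda>x. gauss l x * cos (\<omega> * x)" and ?g2 = "\<lambda>x. gauss_deriv2 l x * cos (\<omega> * x)"
    have s: "sin (\<omega> * real N) = 0" "cos (\<omega> * real N) = 1"
      using sin_npi[of "2 * k * N"] cos_npi[of "2 * k * N"] by (simp_all add: \<omega>_def mult_ac)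
    have "integral {0..real N} ?g = gauss_deriv l (real N) / \<omega>\<^sup>2 - integral {0..real N} ?g2 / \<omega>\<^sup>2"
      by (subst integral_cos_by_parts_twice[OF gauss_has_deriv[OF l] gauss_deriv_has_deriv[OF l]
            continuous_on_gauss_deriv2[OF l] \<omega>])
         (auto simp: s gauss_deriv_def)
    then have 1: "integral {0..real N} ?g2 = gauss_deriv l (real N) - \<omega>\<^sup>2 * integral {0..real N} ?g"
      using \<omega> by (simp add: field_simps)
    have i: "?g integrable_on {0..real N}" "?g2 integrable_on {0..real N}"
      by (intro integrable_continuous_real continuous_intros continuous_on_gauss continuous_on_gauss_deriv2 l)+
    have "dgauss l x * cos (\<omega> * x) = l\<^sup>2 / 2 * ?g2 x + 1 / 2 * ?g x" for x
      using l by (simp add: dgauss_def gauss_deriv2_def field_simps)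
    then have "integral {0..real N} (\<lambda>x. dgauss l x * cos (\<omega> * x)) =
      l\<^sup>2 / 2 * integral {0..real N} ?g2 + 1 / 2 * integral {0..real N} ?g"
      using integral_add[OF integrable_on_cmult_left[OF i(2)] integrable_on_cmult_left[OF i(1)], of "l\<^sup>2 / 2" "1 / 2"]
      by simp
    also have "\<dots> = (1/2 - l\<^sup>2 * \<omega>\<^sup>2 / 2) * integral {0..real N} ?g + l\<^sup>2 / 2 * gauss_deriv l (real N)"
      unfolding 1 by (simp add: field_simps)
    finally show ?thesis unfolding t by simp
  qed
  have "(\<lambda>N. integral {0..real N} (\<lambda>x. dgauss l x * cos (\<omega> * x)))
    \<longlonglongrightarrow> (1/2 - t\<^sup>2) * (l * sqrt (2 * pi) / 2 * exp (- t\<^sup>2)) + l\<^sup>2 / 2 * 0"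
    unfolding eq unfolding t_def \<omega>_def
    by (intro tendsto_add tendsto_mult_left gauss_integral_tendsto gauss_deriv_tendsto_0 l k)
  then show ?thesis by (simp add: \<omega>_def)
qed

text \<open>The reason for the variable t = sqrt 2 * pi * l * k: it turns the exponent of the
  whole-line integral into - t^2 and, as shown here, the tail bound of
  \<open>cos_coeff_bound\<close> into C / t^2.\<close>

lemma tail_term_eq:
  assumes "l > 0"
  shows "C / l\<^sup>2 / (2 * pi\<^sup>2 * (real k)\<^sup>2) = C / (sqrt 2 * pi * l * real k)\<^sup>2"
  using assms by (simp add: power_mult_distrib mult_ac)

lemma cos_coeff_gauss_le:
  assumes l: "l > 0" and k: "k > 0"
  shows "\<bar>cos_coeff (gauss l) k\<bar> \<le> gamma_term (sqrt 2 * pi * l * real k) l"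
  using cos_coeff_bound[OF gauss_has_deriv[OF l] gauss_deriv_has_deriv[OF l] continuous_on_gauss_deriv2[OF l]
      k gauss_integral_tendsto[OF l k] gauss_deriv_variation[OF l]] l
  by (simp only: tail_term_eq[OF l] gamma_term_eq) (simp add: abs_mult)

lemma cos_coeff_dgauss_le:
  assumes l: "l > 0" and k: "k > 0"
  shows "\<bar>cos_coeff (dgauss l) k\<bar> \<le> xi_term (sqrt 2 * pi * l * real k) l"
proof -
  define t where "t = sqrt 2 * pi * l * real k"
  have "\<bar>cos_coeff (dgauss l) k\<bar> \<le>
      2 * \<bar>(1/2 - t\<^sup>2) * (l * sqrt (2 * pi) / 2 * exp (- t\<^sup>2))\<bar> + dgauss_tail l / t\<^sup>2"
    using cos_coeff_bound[OF dgauss_has_deriv[OF l] dgauss_deriv_has_deriv[OF l] continuous_on_dgauss_deriv2[OF l]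
      k dgauss_integral_tendsto[OF l k] dgauss_deriv_variation[OF l]]
    by (simp only: tail_term_eq[OF l] t_def)
  also have "2 * \<bar>(1/2 - t\<^sup>2) * (l * sqrt (2 * pi) / 2 * exp (- t\<^sup>2))\<bar> =
      \<bar>1/2 - t\<^sup>2\<bar> * (l * sqrt (2 * pi) * exp (- t\<^sup>2))"
    using l by (simp add: abs_mult)
  also have "\<dots> \<le> (t\<^sup>2 + 1/2) * (l * sqrt (2 * pi) * exp (- t\<^sup>2))"
    using l by (intro mult_right_mono) (auto simp: abs_if)
  finally show ?thesis by (simp add: xi_term_eq t_def mult_ac)
qed

text \<open>The integral test by the mean value theorem: F n - F (n + 1) = - F' z for some z between
  n and n + 1, and z \<le> n + 1 gives g (n + 1) \<le> - F' z. The sum telescopes, and F N \<ge> 0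
  is dropped. The hypothesis in two variables merges the monotonicity of g with its domination by -
  F', so F need not be an exact antiderivative.\<close>

lemma sum_le_of_antiderivative:
  fixes F g :: "real \<Rightarrow> real"
  assumes F: "\<And>x. x \<ge> real M \<Longrightarrow> (F has_real_derivative F' x) (at x)"
    and le: "\<And>x y. real M \<le> x \<Longrightarrow> x \<le> y \<Longrightarrow> g y \<le> - F' x"
    and nonneg: "\<And>x. x \<ge> real M \<Longrightarrow> F x \<ge> 0"
  shows "(\<Sum>k\<in>{M<..N}. g (real k)) \<le> F (real M)"
proof (cases "M \<le> N")
  case True
  have "(\<Sum>k\<in>{M<..N}. g (real k)) \<le> F (real M) - F (real N)"
    using True
  proof (induction N rule: dec_induct)
    case (step n)
    obtain z where z: "real n < z" "z < real (Suc n)"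
        and eq: "F (real (Suc n)) - F (real n) = (real (Suc n) - real n) * F' z"
      using MVT2[of "real n" "real (Suc n)" F F'] F step(1) by force
    have "g (real (Suc n)) \<le> - F' z"
      by (rule le) (use z step(1) in auto)
    moreover have "{M<..Suc n} = insert (Suc n) {M<..n}" using step(1) by auto
    ultimately show ?case using step.IH eq by simp
  qed simp
  also have "\<dots> \<le> F (real M)" using nonneg[of "real N"] True by simp
  finally show ?thesis .
next
  case False
  then show ?thesis using nonneg[of "real M"] by simp
qed



section \<open>Trigonometric interpolation in one variable\<close>

definition freqs :: "nat \<Rightarrow> int set" where
  "freqs m = {k. - real m / 2 \<le> of_int k \<and> of_int k < real m / 2}"

text \<open>Complex-valued input, so that the interpolant can be evaluated on the exponentials
  themselves, where aliasing is visible.\<close>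

definition dft :: "(real \<Rightarrow> complex) \<Rightarrow> nat \<Rightarrow> int \<Rightarrow> complex" where
  "dft u m k = 1 / of_nat m * (\<Sum>j\<in>freqs m. u (of_int j / real m) * cis (- (2 * pi * (of_int j * of_int k) / real m)))"

definition trig_interp :: "(real \<Rightarrow> complex) \<Rightarrow> nat \<Rightarrow> real \<Rightarrow> complex" where
  "trig_interp u m x = (\<Sum>k\<in>freqs m. dft u m k * cis (2 * pi * (of_int k * x)))"

lemma freqs_even: "freqs (2 * M) = {- int M..<int M}"
proof -
  have "(- real (2 * M) / 2 \<le> of_int k \<and> of_int k < real (2 * M) / 2) \<longleftrightarrow> (- int M \<le> k \<and> k < int M)" for k
  proof -
    have "(- real (2 * M) / 2 \<le> of_int k) \<longleftrightarrow> real_of_int (- int M) \<le> of_int k"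
      "(of_int k < real (2 * M) / 2) \<longleftrightarrow> of_int k < real_of_int (int M)" by simp_all
    then show ?thesis by (simp only: of_int_le_iff of_int_less_iff)
  qed
  then show ?thesis unfolding freqs_def by (intro set_eqI) (simp only: mem_Collect_eq atLeastLessThan_iff)
qed

lemma cis_2pi_int_eq_1: "cis (2 * pi * of_int n) = 1"
  by (simp add: cis.ctr complex_eq_iff cos_int_2pin sin_int_2pin)

text \<open>Orthogonality of characters: a geometric sum in a root w with w ^ (2 * M) = 1, where w =
  1 only if 2 * M divides d. Shifting the indices to start at 0 costs the constant factor cis (- (pi
  * d)).\<close>

lemma sum_cis_freqs:
  assumes M: "M > 0"
  shows "(\<Sum>j\<in>freqs (2 * M). cis (2 * pi * (of_int j * of_int d) / real (2 * M))) =
    (if int (2 * M) dvd d then of_nat (2 * M) else 0)"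
proof (cases "int (2 * M) dvd d")
  case True
  then obtain e where e: "d = int (2 * M) * e" by (auto elim: dvdE)
  have "cis (2 * pi * (of_int j * of_int d) / real (2 * M)) = 1" for j
  proof -
    have "2 * pi * (of_int j * of_int d) / real (2 * M) = 2 * pi * of_int (j * e)"
      using M by (simp add: e)
    then show ?thesis by (simp only: cis_2pi_int_eq_1)
  qed
  then show ?thesis using True by (simp add: freqs_even)
next
  case False
  define w where "w = cis (2 * pi * of_int d / real (2 * M))"
  have w1: "w \<noteq> 1"
  proof
    assume "w = 1"
    then have "cos (2 * pi * of_int d / real (2 * M)) = 1"
      by (simp add: w_def complex_eq_iff)
    then obtain n where "2 * pi * of_int d / real (2 * M) = of_int n * 2 * pi"
      unfolding cos_one_2pi_int by auto
    then have "real_of_int d = real_of_int (int (2 * M) * n)" using M by (simp add: field_simps)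
    then have "d = int (2 * M) * n" by (simp only: of_int_eq_iff)
    with False show False by simp
  qed
  have "real (2 * M) * (2 * pi * of_int d / real (2 * M)) = 2 * pi * of_int d"
    using M by simp
  then have "w ^ (2 * M) = cis (2 * pi * of_int d)"
    unfolding w_def Complex.DeMoivre by (rule arg_cong)
  then have wM: "w ^ (2 * M) = 1" by (simp only: cis_2pi_int_eq_1)
  have "(\<Sum>j\<in>freqs (2 * M). cis (2 * pi * (of_int j * of_int d) / real (2 * M))) =
      (\<Sum>i<2 * M. cis (2 * pi * (of_int (int i - int M) * of_int d) / real (2 * M)))"
    unfolding freqs_even
    by (rule sum.reindex_bij_witness[of _ "\<lambda>i. int i - int M" "\<lambda>j. nat (j + int M)"]) auto
  also have "\<dots> = (\<Sum>i<2 * M. cis (- (pi * of_int d)) * w ^ i)"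
  proof (rule sum.cong[OF refl])
    fix i
    have "2 * pi * (of_int (int i - int M) * of_int d) / real (2 * M) =
      - (pi * of_int d) + real i * (2 * pi * of_int d / real (2 * M))"
      using M by (simp add: field_simps)
    then show "cis (2 * pi * (of_int (int i - int M) * of_int d) / real (2 * M)) = cis (- (pi * of_int d)) * w ^ i"
      unfolding w_def Complex.DeMoivre by (simp only: cis_mult)
  qed
  also have "\<dots> = 0"
    using w1 wM by (simp flip: sum_distrib_left add: geometric_sum)
  finally show ?thesis using False by simp
qed

text \<open>Aliasing: on the grid, exponentials whose frequencies agree modulo 2 * M coincide, and
  \<open>freqs\<close> contains exactly one representative n' of each residue class.\<close>

lemma trig_interp_cis:
  assumes M: "M > 0" and n': "n' \<in> freqs (2 * M)" "int (2 * M) dvd n - n'"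
  shows "trig_interp (\<lambda>y. cis (2 * pi * (of_int n * y))) (2 * M) x = cis (2 * pi * (of_int n' * x))"
proof -
  have uniq: "int (2 * M) dvd n - k \<longleftrightarrow> k = n'" if k: "k \<in> freqs (2 * M)" for k
  proof
    assume "int (2 * M) dvd n - k"
    then have "int (2 * M) dvd (n - n') - (n - k)" using n'(2) by (rule dvd_diff[rotated])
    then have "int (2 * M) dvd k - n'" by simp
    moreover have "\<bar>k - n'\<bar> < int (2 * M)" using k n' by (auto simp: freqs_even)
    ultimately show "k = n'" using dvd_imp_le_int[of "k - n'" "int (2 * M)"] by force
  qed (use n' in simp)
  have "dft (\<lambda>y. cis (2 * pi * (of_int n * y))) (2 * M) k = (if k = n' then 1 else 0)"
    if k: "k \<in> freqs (2 * M)" for k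
  proof -
    have "cis (2 * pi * (of_int n * (of_int j / real (2 * M)))) * cis (- (2 * pi * (of_int j * of_int k) / real (2 * M)))
      = cis (2 * pi * (of_int j * of_int (n - k)) / real (2 * M))" for j
      unfolding cis_mult by (rule arg_cong[of _ _ cis]) (use M in \<open>simp add: field_simps\<close>)
    then show ?thesis
      unfolding dft_def using M uniq[OF k] by (simp only: sum_cis_freqs) auto
  qed
  then have "trig_interp (\<lambda>y. cis (2 * pi * (of_int n * y))) (2 * M) x =
    (\<Sum>k\<in>freqs (2 * M). if k = n' then cis (2 * pi * (of_int k * x)) else 0)"
    unfolding trig_interp_def by (intro sum.cong refl) auto
  also have "\<dots> = cis (2 * pi * (of_int n' * x))"
    using n'(1) by (subst sum.delta) (auto simp: freqs_even)
  finally show ?thesis .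
qed

lemma trig_interp_add:
  "trig_interp (\<lambda>y. u y + v y) m x = trig_interp u m x + trig_interp v m x"
  by (simp add: trig_interp_def dft_def distrib_left distrib_right sum.distrib)

lemma trig_interp_cmult:
  "trig_interp (\<lambda>y. c * u y) m x = c * trig_interp u m x"
  by (simp add: trig_interp_def dft_def sum_distrib_left mult_ac)

text \<open>The interpolant is a finite linear combination of values of u, so pointwise convergence
  suffices.\<close>

lemma trig_interp_sums:
  assumes "\<And>y. (\<lambda>n. v n y) sums u y"
  shows "(\<lambda>n. trig_interp (v n) m x) sums trig_interp u m x"
  unfolding trig_interp_def dft_def
  by (intro sums_sum sums_mult sums_mult2 assms)

lemma trig_interp_cos:
  assumes M: "M > 0" and "p \<in> freqs (2 * M)" "int (2 * M) dvd int n - p"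
    and "q \<in> freqs (2 * M)" "int (2 * M) dvd - int n - q"
  shows "trig_interp (\<lambda>y. of_real (cos (2 * pi * real n * y))) (2 * M) x =
    (cis (2 * pi * (of_int p * x)) + cis (2 * pi * (of_int q * x))) / 2"
proof -
  have eq: "complex_of_real (cos (2 * pi * real n * y)) =
      1/2 * (cis (2 * pi * (of_int (int n) * y)) + cis (2 * pi * (of_int (- int n) * y)))" for y
    by (simp add: complex_eq_iff mult.assoc)
  show ?thesis
    unfolding eq trig_interp_cmult trig_interp_add
    using assms by (simp only: trig_interp_cis) simp
qed

text \<open>On the grid the frequencies n and -n are aliased to residues modulo 2 M. They are unchanged for n < M,
  and both become -M for n = M, which leaves an error of modulus |sin (2 pi M x)|.\<close>
lemma trig_interp_cos_error:
  assumes M: "M > 0"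
  shows "norm (of_real (cos (2 * pi * real n * x)) - trig_interp (\<lambda>y. of_real (cos (2 * pi * real n * y))) (2 * M) x)
    \<le> (if n < M then 0 else if n = M then 1 else 2)"
proof -
  consider "n < M" | "n = M" | "n > M" by linarith
  then show ?thesis
  proof cases
    case 1
    have "trig_interp (\<lambda>y. of_real (cos (2 * pi * real n * y))) (2 * M) x = of_real (cos (2 * pi * real n * x))"
      using 1 by (subst trig_interp_cos[OF M, of "int n" _ "- int n"]) (auto simp: freqs_even complex_eq_iff mult.assoc)
    then show ?thesis by simp
  next
    case 2
    have "trig_interp (\<lambda>y. of_real (cos (2 * pi * real n * y))) (2 * M) x = cis (- (2 * pi * real M * x))"
      using 2 M by (subst trig_interp_cos[OF M, of "- int M" _ "- int M"]) (auto simp: freqs_even mult.assoc)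
    moreover have "of_real (cos \<theta>) - cis (- \<theta>) = \<i> * of_real (sin \<theta>)" for \<theta>
      by (simp add: complex_eq_iff)
    ultimately show ?thesis using 2 by (simp add: norm_mult)
  next
    case 3
    have ex: "\<exists>p\<in>freqs (2 * M). int (2 * M) dvd d - p" for d
    proof -
      let ?p = "(d + int M) mod int (2 * M) - int M"
      have "0 \<le> (d + int M) mod int (2 * M)" "(d + int M) mod int (2 * M) < int (2 * M)"
        using M by simp_all
      then have "?p \<in> freqs (2 * M)" unfolding freqs_even by auto
      moreover have "int (2 * M) dvd d - ?p"
        using dvd_minus_mod[of "int (2 * M)" "d + int M"] by (simp add: algebra_simps)
      ultimately show ?thesis by blast
    qed
    obtain p q where pq: "p \<in> freqs (2 * M)" "int (2 * M) dvd int n - p"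
        "q \<in> freqs (2 * M)" "int (2 * M) dvd - int n - q"
      using ex[of "int n"] ex[of "- int n"] by blast
    have "norm (trig_interp (\<lambda>y. of_real (cos (2 * pi * real n * y))) (2 * M) x) \<le> (1 + 1) / 2"
      unfolding trig_interp_cos[OF M pq]
      using norm_triangle_ineq[of "cis (2 * pi * (of_int p * x))" "cis (2 * pi * (of_int q * x))"]
      by (simp add: norm_divide)
    moreover have "norm (complex_of_real (cos (2 * pi * real n * x))) \<le> 1"
      by (simp only: norm_of_real real_norm_def abs_cos_le_one)
    ultimately have "norm (of_real (cos (2 * pi * real n * x)) - trig_interp (\<lambda>y. of_real (cos (2 * pi * real n * y))) (2 * M) x)
      \<le> 1 + (1 + 1) / 2"
      by (intro order_trans[OF norm_triangle_ineq4 add_mono])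
    then show ?thesis using 3 by simp
  qed
qed

section \<open>The interpolation error of an even, periodically continued function\<close>

definition periodic :: "(real \<Rightarrow> real) \<Rightarrow> real \<Rightarrow> real" where
  "periodic h x = h (x - of_int (round x))"

text \<open>The series is known on [0, 1/2], where the modulus of x - round x lies. Evenness of h
  and of the cosine removes the modulus, and periodicity of the cosine removes round x.\<close>

lemma periodic_cos_series_sums:
  fixes h :: "real \<Rightarrow> real"
  defines "b \<equiv> \<lambda>k. if k = 0 then cos_coeff h 0 else 2 * cos_coeff h k"
  assumes h: "continuous_on {0..1/2} h" and even: "\<And>x. h (- x) = h x"
    and summ: "summable (\<lambda>k. \<bar>b k\<bar>)"
  shows "(\<lambda>k. b k * cos (2 * pi * real k * x)) sums periodic h x"
proof -
  let ?z = "x - of_int (round x)"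
  have "\<bar>?z\<bar> \<le> 1/2" using of_int_round_abs_le[of x] by (simp add: abs_minus_commute)
  then have "(\<lambda>k. b k * cos (2 * pi * real k * \<bar>?z\<bar>)) sums h \<bar>?z\<bar>"
    unfolding b_def by (intro cos_series_sums h summ[unfolded b_def]) auto
  moreover have "h \<bar>?z\<bar> = periodic h x" using even[of ?z] by (auto simp: periodic_def abs_if)
  moreover have "cos (2 * pi * real k * \<bar>?z\<bar>) = cos (2 * pi * real k * x)" for k
  proof -
    have "cos (2 * pi * real k * \<bar>?z\<bar>) = cos (2 * pi * real k * ?z)"
      using cos_abs_real[of "2 * pi * real k * ?z"] unfolding abs_mult by simp
    also have "2 * pi * real k * ?z = 2 * pi * real k * x - 2 * pi * of_int (int k * round x)"
      by (simp add: algebra_simps)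
    also have "cos \<dots> = cos (2 * pi * real k * x)"
      unfolding cos_diff cos_int_2pin sin_int_2pin by simp
    finally show ?thesis .
  qed
  ultimately show ?thesis by simp
qed

text \<open>By linearity the error is the series of b k times the error for the k-th cosine. The
  latter is 0, at most 1 and at most 2 for k below, at and above M. Together with b k = 2 *
  \<open>cos_coeff h k\<close> this explains the factors 2 and 4.\<close>

lemma trig_interp_error_le:
  fixes h :: "real \<Rightarrow> real"
  assumes h: "continuous_on {0..1/2} h" and even: "\<And>x. h (- x) = h x" and M: "M > 0"
    and s: "\<bar>cos_coeff h M\<bar> \<le> s" and S: "\<And>N. (\<Sum>k\<in>{M<..N}. \<bar>cos_coeff h k\<bar>) \<le> S"
  shows "norm (of_real (periodic h x) - trig_interp (\<lambda>y. of_real (periodic h y)) (2 * M) x) \<le> 2 * s + 4 * S"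
proof -
  define b where "b = (\<lambda>k. if k = 0 then cos_coeff h 0 else 2 * cos_coeff h k)"
  have S': "(\<Sum>k\<in>{M<..N}. \<bar>b k\<bar>) \<le> 2 * S" for N
    using S[of N] by (simp add: b_def abs_mult flip: sum_distrib_left)
  have sub: "{..<N} \<subseteq> {..M} \<union> {M<..N}" for N by auto
  have split: "(\<Sum>k<N. f k) \<le> (\<Sum>k\<le>M. f k) + (\<Sum>k\<in>{M<..N}. f k)" if "\<And>k. f k \<ge> 0" for f :: "nat \<Rightarrow> real" and N
  proof -
    have "(\<Sum>k<N. f k) \<le> sum f ({..M} \<union> {M<..N})"
      by (rule sum_mono2[OF _ sub]) (use that in auto)
    also have "\<dots> = (\<Sum>k\<le>M. f k) + (\<Sum>k\<in>{M<..N}. f k)"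
      by (rule sum.union_disjoint) auto
    finally show ?thesis .
  qed
  \<comment> \<open>The uniform bound on the partial sums beyond M also provides the absolute
    summability that the cosine series requires.\<close>
  have summ: "summable (\<lambda>k. \<bar>b k\<bar>)"
  proof (rule summableI_nonneg_bounded)
    show "(\<Sum>k<N. \<bar>b k\<bar>) \<le> (\<Sum>k\<le>M. \<bar>b k\<bar>) + 2 * S" for N
      using split[of "\<lambda>k. \<bar>b k\<bar>" N] S'[of N] by simp
  qed simp
  have series: "(\<lambda>k. complex_of_real (b k) * of_real (cos (2 * pi * real k * y))) sums of_real (periodic h y)" for y
    using sums_of_real[OF periodic_cos_series_sums[OF h even, of y]] summ by (simp add: b_def)
  define e where "e k = complex_of_real (cos (2 * pi * real k * x)) -
    trig_interp (\<lambda>y. of_real (cos (2 * pi * real k * y))) (2 * M) x" for k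
  have interp: "(\<lambda>k. trig_interp (\<lambda>y. of_real (b k) * of_real (cos (2 * pi * real k * y))) (2 * M) x) sums
      trig_interp (\<lambda>y. of_real (periodic h y)) (2 * M) x"
    by (rule trig_interp_sums) (rule series)
  have "(\<lambda>k. of_real (b k) * e k) sums (of_real (periodic h x) - trig_interp (\<lambda>y. of_real (periodic h y)) (2 * M) x)"
    using sums_diff[OF series[of x] interp] unfolding e_def trig_interp_cmult right_diff_distrib .
  then have lim: "(\<lambda>N. norm (\<Sum>k<N. of_real (b k) * e k)) \<longlonglongrightarrow>
      norm (of_real (periodic h x) - trig_interp (\<lambda>y. of_real (periodic h y)) (2 * M) x)"
    unfolding sums_def by (rule tendsto_norm)
  have e: "norm (e k) \<le> (if k < M then 0 else if k = M then 1 else 2)" for k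
    unfolding e_def by (rule trig_interp_cos_error[OF M])
  have "norm (\<Sum>k<N. of_real (b k) * e k) \<le> 2 * s + 4 * S" for N
  proof -
    have "norm (\<Sum>k<N. of_real (b k) * e k) \<le> (\<Sum>k<N. \<bar>b k\<bar> * (if k < M then 0 else if k = M then 1 else 2))"
      by (intro order_trans[OF norm_sum sum_mono], unfold norm_mult norm_of_real) (intro mult_left_mono e abs_ge_zero)
    also have "\<dots> \<le> (\<Sum>k\<le>M. \<bar>b k\<bar> * (if k < M then 0 else if k = M then 1 else 2)) +
        (\<Sum>k\<in>{M<..N}. \<bar>b k\<bar> * (if k < M then 0 else if k = M then 1 else 2))"
      by (rule split) simp
    also have "(\<Sum>k\<le>M. \<bar>b k\<bar> * (if k < M then 0 else if k = M then 1 else 2)) = (\<Sum>k\<le>M. if k = M then \<bar>b k\<bar> else 0)"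
      by (rule sum.cong) auto
    also have "\<dots> = 2 * \<bar>cos_coeff h M\<bar>" using M by (simp add: b_def abs_mult)
    also have "(\<Sum>k\<in>{M<..N}. \<bar>b k\<bar> * (if k < M then 0 else if k = M then 1 else 2)) = 2 * (\<Sum>k\<in>{M<..N}. \<bar>b k\<bar>)"
      unfolding sum_distrib_left by (rule sum.cong) auto
    finally show ?thesis using s S'[of N] by linarith
  qed
  then show ?thesis by (intro LIMSEQ_le_const2[OF lim]) auto
qed



section \<open>Tensor products\<close>

lemma sum_index_set:
  fixes F :: "int \<Rightarrow> int \<Rightarrow> int \<Rightarrow> 'a::comm_monoid_add"
  shows "(\<Sum>k\<in>index_set m. F (k $ 1) (k $ 2) (k $ 3)) = (\<Sum>a\<in>freqs m. \<Sum>b\<in>freqs m. \<Sum>c\<in>freqs m. F a b c)"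
  unfolding sum.cartesian_product
  by (rule sum.reindex_bij_witness[of _ "\<lambda>(a, b, c). vector [a, b, c]" "\<lambda>k. (k $ 1, k $ 2, k $ 3)"])
     (auto simp: index_set_def freqs_def forall_3 vec_eq_iff)

lemma sum_mult_sum_mult_sum:
  fixes u v w :: "'a \<Rightarrow> 'b::comm_semiring_0"
  shows "(\<Sum>a\<in>A. \<Sum>b\<in>A. \<Sum>c\<in>A. u a * v b * w c) = sum u A * sum v A * sum w A"
  by (simp add: mult.assoc flip: sum_distrib_left sum_distrib_right)

lemma exp_2pi_eq_cis: "exp (2 * of_real pi * \<i> * of_real x) = cis (2 * pi * x)"
  by (simp add: cis_conv_exp mult_ac)

lemma inner_of_int_vec: "of_int_vec k \<bullet> r = of_int (k $ 1) * r $ 1 + of_int (k $ 2) * r $ 2 + of_int (k $ 3) * r $ 3"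
  by (simp add: inner_vec_def sum_3 of_int_vec_def)

text \<open>The exponential factors over the coordinates and the index set is a cube, so the triple
  sum is a product of three sums.\<close>

lemma fourier_coeff_product:
  "fourier_coeff (\<lambda>r. u (r $ 1) * v (r $ 2) * w (r $ 3)) m k =
    dft (\<lambda>y. of_real (u y)) m (k $ 1) * dft (\<lambda>y. of_real (v y)) m (k $ 2) * dft (\<lambda>y. of_real (w y)) m (k $ 3)"
proof -
  define c where "c h n j = of_real (h (of_int j / real m)) * cis (- (2 * pi * (of_int j * of_int n) / real m))"
    for h :: "real \<Rightarrow> real" and n j :: int
  have eq: "of_real (u (((1 / real m) *\<^sub>R of_int_vec j) $ 1) * v (((1 / real m) *\<^sub>R of_int_vec j) $ 2) * w (((1 / real m) *\<^sub>R of_int_vec j) $ 3)) *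
      exp (- 2 * of_real pi * \<i> * of_real (of_int_vec j \<bullet> of_int_vec k) / of_nat m) =
      c u (k $ 1) (j $ 1) * c v (k $ 2) (j $ 2) * c w (k $ 3) (j $ 3)" for j
  proof -
    have "- 2 * of_real pi * \<i> * of_real (of_int_vec j \<bullet> of_int_vec k) / of_nat m =
        2 * of_real pi * \<i> * of_real (- (of_int_vec j \<bullet> of_int_vec k) / real m)"
      by simp
    moreover have "of_int_vec j \<bullet> of_int_vec k = of_int (j $ 1) * of_int (k $ 1) + of_int (j $ 2) * of_int (k $ 2) +
        of_int (j $ 3) * of_int (k $ 3)"
      unfolding inner_of_int_vec by (simp add: of_int_vec_def)
    then have "2 * pi * (- (of_int_vec j \<bullet> of_int_vec k) / real m) =
        - (2 * pi * (of_int (j $ 1) * of_int (k $ 1)) / real m) +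
        - (2 * pi * (of_int (j $ 2) * of_int (k $ 2)) / real m) +
        - (2 * pi * (of_int (j $ 3) * of_int (k $ 3)) / real m)"
      by (simp add: add_divide_distrib diff_divide_distrib algebra_simps)
    ultimately have "exp (- 2 * of_real pi * \<i> * of_real (of_int_vec j \<bullet> of_int_vec k) / of_nat m) =
        cis (- (2 * pi * (of_int (j $ 1) * of_int (k $ 1)) / real m)) *
        cis (- (2 * pi * (of_int (j $ 2) * of_int (k $ 2)) / real m)) *
        cis (- (2 * pi * (of_int (j $ 3) * of_int (k $ 3)) / real m))"
      by (simp only: exp_2pi_eq_cis cis_mult)
    then show ?thesis by (simp add: c_def of_int_vec_def mult_ac)
  qed
  have dft: "dft (\<lambda>y. of_real (h y)) m n = 1 / of_nat m * sum (c h n) (freqs m)" for h n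
    by (simp add: dft_def c_def)
  show ?thesis
    unfolding fourier_coeff_def eq sum_index_set[of "\<lambda>a b d. c u (k $ 1) a * c v (k $ 2) b * c w (k $ 3) d"]
      sum_mult_sum_mult_sum dft
    by (simp add: power3_eq_cube)
qed

lemma fourier_approx_product:
  "fourier_approx (\<lambda>r. u (r $ 1) * v (r $ 2) * w (r $ 3)) m r =
    trig_interp (\<lambda>y. of_real (u y)) m (r $ 1) * trig_interp (\<lambda>y. of_real (v y)) m (r $ 2) *
    trig_interp (\<lambda>y. of_real (w y)) m (r $ 3)"
proof -
  define c where "c h x n = dft (\<lambda>y. of_real (h y)) m n * cis (2 * pi * (of_int n * x))" for h :: "real \<Rightarrow> real" and x n
  have eq: "fourier_coeff (\<lambda>r. u (r $ 1) * v (r $ 2) * w (r $ 3)) m k * exp (2 * of_real pi * \<i> * of_real (of_int_vec k \<bullet> r)) =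
      c u (r $ 1) (k $ 1) * c v (r $ 2) (k $ 2) * c w (r $ 3) (k $ 3)" for k
  proof -
    have E: "exp (2 * of_real pi * \<i> * of_real (of_int_vec k \<bullet> r)) =
      cis (2 * pi * (of_int (k $ 1) * r $ 1)) * cis (2 * pi * (of_int (k $ 2) * r $ 2)) * cis (2 * pi * (of_int (k $ 3) * r $ 3))"
      unfolding exp_2pi_eq_cis cis_mult inner_of_int_vec by (rule arg_cong[of _ _ cis]) (simp add: algebra_simps)
    show ?thesis unfolding E fourier_coeff_product c_def by (simp only: mult_ac)
  qed
  have trig: "trig_interp (\<lambda>y. of_real (h y)) m x = sum (c h x) (freqs m)" for h x
    by (simp add: trig_interp_def c_def)
  show ?thesis
    unfolding fourier_approx_def eq sum_index_set[of "\<lambda>a b d. c u (r $ 1) a * c v (r $ 2) b * c w (r $ 3) d"]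
      sum_mult_sum_mult_sum trig ..
qed

lemma fourier_approx_add:
  "fourier_approx (\<lambda>r. K r + K' r) m r = fourier_approx K m r + fourier_approx K' m r"
  by (simp add: fourier_approx_def fourier_coeff_def distrib_left distrib_right sum.distrib)

lemma der_gauss_kernel_eq:
  "der_gauss_kernel l r =
    periodic (dgauss l) (r $ 1) * periodic (gauss l) (r $ 2) * periodic (gauss l) (r $ 3) +
    periodic (gauss l) (r $ 1) * periodic (dgauss l) (r $ 2) * periodic (gauss l) (r $ 3) +
    periodic (gauss l) (r $ 1) * periodic (gauss l) (r $ 2) * periodic (dgauss l) (r $ 3)"
proof -
  have "der_gauss l z = dgauss l (z $ 1) * gauss l (z $ 2) * gauss l (z $ 3) +
      gauss l (z $ 1) * dgauss l (z $ 2) * gauss l (z $ 3) +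
      gauss l (z $ 1) * gauss l (z $ 2) * dgauss l (z $ 3)" for z
  proof -
    have n: "(norm z)\<^sup>2 / (2 * l\<^sup>2) = (z $ 1)\<^sup>2 / (2 * l\<^sup>2) + (z $ 2)\<^sup>2 / (2 * l\<^sup>2) + (z $ 3)\<^sup>2 / (2 * l\<^sup>2)"
      unfolding power2_norm_eq_inner inner_vec_def sum_3 by (simp add: power2_eq_square add_divide_distrib)
    have "exp (- (a + b + c)) = exp (- a) * exp (- b) * exp (- c)" for a b c :: real
      by (simp flip: exp_add)
    then show ?thesis
      unfolding der_gauss_def n dgauss_def gauss_def by (simp add: algebra_simps)
  qed
  then show ?thesis by (simp add: der_gauss_kernel_def periodic_cont_def periodic_def)
qed

text \<open>The factors are exchanged in an order in which F occurs only in f - F, so \<beta> enters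
  linearly. Of the interpolants, G and H stand alone and are bounded by 1 + \<alpha>, while f and h
  are bounded by 1.\<close>

lemma norm_triple_product_diff_le:
  fixes f g h F G H :: complex
  assumes "norm (f - F) \<le> \<beta>" "norm (g - G) \<le> \<alpha>" "norm (h - H) \<le> \<alpha>"
    and "norm f \<le> 1" "norm g \<le> 1" "norm h \<le> 1"
  shows "norm (f * g * h - F * G * H) \<le> \<beta> * (1 + \<alpha>)\<^sup>2 + 2 * \<alpha> + \<alpha>\<^sup>2"
proof -
  have G: "norm G \<le> 1 + \<alpha>" "norm H \<le> 1 + \<alpha>"
    using assms norm_triangle_ineq2[of G g] norm_triangle_ineq2[of H h] by (auto simp: norm_minus_commute)
  have nn: "0 \<le> \<alpha>" "0 \<le> \<beta>" using assms(1,2) norm_ge_zero order_trans by blast+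
  have "f * g * h - F * G * H = (f - F) * (G * H) + f * ((g - G) * h + G * (h - H))"
    by (simp add: algebra_simps)
  also have "norm \<dots> \<le> norm (f - F) * (norm G * norm H) + norm f * (norm (g - G) * norm h + norm G * norm (h - H))"
    by (intro order_trans[OF norm_triangle_ineq] add_mono order_refl mult_left_mono | simp only: norm_mult norm_ge_zero)+
  also have "\<dots> \<le> \<beta> * ((1 + \<alpha>) * (1 + \<alpha>)) + 1 * (\<alpha> * 1 + (1 + \<alpha>) * \<alpha>)"
    using assms G nn by (intro add_mono mult_mono) auto
  finally show ?thesis by (simp add: power2_eq_square algebra_simps)
qed

lemma fourier_err_der_gauss_le:
  assumes l: "l > 0"
    and g: "\<And>x. norm (of_real (periodic (gauss l) x) - trig_interp (\<lambda>y. of_real (periodic (gauss l) y)) m x) \<le> \<alpha>"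
    and f: "\<And>x. norm (of_real (periodic (dgauss l) x) - trig_interp (\<lambda>y. of_real (periodic (dgauss l) y)) m x) \<le> \<beta>"
  shows "norm (fourier_err (der_gauss_kernel l) m r) \<le> 3 * (\<beta> * (1 + \<alpha>)\<^sup>2 + 2 * \<alpha> + \<alpha>\<^sup>2)"
proof -
  define F where "F i = complex_of_real (periodic (dgauss l) (r $ i))" for i
  define G where "G i = complex_of_real (periodic (gauss l) (r $ i))" for i
  define F' where "F' i = trig_interp (\<lambda>y. of_real (periodic (dgauss l) y)) m (r $ i)" for i
  define G' where "G' i = trig_interp (\<lambda>y. of_real (periodic (gauss l) y)) m (r $ i)" for i
  have "gauss l x \<le> 1" for x by (simp add: gauss_def)
  then have G1: "norm (G i) \<le> 1" for i
    using gauss_pos[of l] by (simp add: G_def periodic_def less_imp_le)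
  have "\<bar>dgauss l x\<bar> \<le> 1" for x
  proof -
    let ?u = "x\<^sup>2 / (2 * l\<^sup>2)"
    have "?u * exp (- ?u) \<le> 1"
      using mult_right_mono[of ?u "exp ?u" "exp (- ?u)"] exp_ge_add_one_self[of ?u]
      by (simp flip: exp_add)
    then show ?thesis by (simp add: dgauss_def gauss_def)
  qed
  then have F1: "norm (F i) \<le> 1" for i by (simp add: F_def periodic_def)
  have d: "norm (F i - F' i) \<le> \<beta>" "norm (G i - G' i) \<le> \<alpha>" for i
    using f g by (simp_all add: F_def F'_def G_def G'_def)
  let ?e = "\<beta> * (1 + \<alpha>)\<^sup>2 + 2 * \<alpha> + \<alpha>\<^sup>2"
  have e: "norm (F i * G j * G k - F' i * G' j * G' k) \<le> ?e" for i j k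
    by (intro norm_triple_product_diff_le d F1 G1)
  have "fourier_approx (der_gauss_kernel l) m r = F' 1 * G' 2 * G' 3 + G' 1 * F' 2 * G' 3 + G' 1 * G' 2 * F' 3"
    unfolding der_gauss_kernel_eq[abs_def] fourier_approx_add fourier_approx_product by (simp add: F'_def G'_def)
  \<comment> \<open>Each product is reordered to begin with the factor from \<open>dgauss\<close>,
    so that one bound serves all three.\<close>
  then have "fourier_err (der_gauss_kernel l) m r =
      (F 1 * G 2 * G 3 - F' 1 * G' 2 * G' 3) + (F 2 * G 1 * G 3 - F' 2 * G' 1 * G' 3) + (F 3 * G 1 * G 2 - F' 3 * G' 1 * G' 2)"
    by (simp add: fourier_err_def der_gauss_kernel_eq F_def G_def algebra_simps)
  also have "norm \<dots> \<le> ?e + ?e + ?e"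
    by (intro order_trans[OF norm_triangle_ineq] add_mono e)
  finally show ?thesis by simp
qed



section \<open>The error terms\<close>

text \<open>The case distinction depends on l only, so for fixed l this is a single formula that can
  be differentiated in t. \<open>S_term_eq\<close> serves the same purpose.\<close>

lemma A_term_eq:
  assumes "l > 0"
  shows "A_term t l = 1 / (2 * t * sqrt pi) * exp (- t\<^sup>2) + gauss_tail l / (sqrt 2 * l * pi * t)"
proof -
  have "2 * l * e / (sqrt 2 * l * pi * t) = 2 / sqrt 2 * e / (pi * t)" for e
    using assms by simp
  then have "2 * l * e / (sqrt 2 * l * pi * t) = sqrt 2 * e / (pi * t)" for e
    by (simp only: real_div_sqrt)
  then show ?thesis
    unfolding A_term_def gauss_tail_def by (cases "l < 1/2") (simp_all only: if_True if_False)
qed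

lemma S_term_eq:
  assumes "l > 0"
  shows "S_term t l = erfc t / 4 + t / (2 * sqrt pi) * exp (- t\<^sup>2) +
    1 / (4 * sqrt pi * t) * exp (- t\<^sup>2) + dgauss_tail l / (sqrt 2 * l * pi * t)"
proof -
  have "e / (8 * sqrt 2 * pi * l ^ 3 * t) = e / (8 * l\<^sup>2) / (sqrt 2 * l * pi * t)" for e
    by (simp add: power3_eq_cube power2_eq_square mult_ac)
  moreover have "1 / (sqrt 2 * pi * l * t) + 3 / (2 * sqrt 2 * pi * t) = (1 + 3 * l / 2) / (sqrt 2 * l * pi * t)"
    using assms by (simp add: add_divide_distrib mult_ac)
  ultimately show ?thesis
    unfolding S_term_def dgauss_tail_def
    by (cases "l \<le> 1/2 * sqrt (2 / (5 + sqrt 17))") (simp_all only: if_True if_False)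
qed

lemma gauss_tail_nonneg: "l > 0 \<Longrightarrow> gauss_tail l \<ge> 0"
  by (simp add: gauss_tail_def)

lemma dgauss_tail_nonneg: "l > 0 \<Longrightarrow> dgauss_tail l \<ge> 0"
  by (simp add: dgauss_tail_def)

section \<open>The complementary error function\<close>

lemma set_integrable_exp_neg_square: "set_integrable lborel {0..x} (\<lambda>t. exp (- t\<^sup>2) :: real)"
  by (intro borel_integrable_atLeastAtMost' continuous_intros)

lemma erfc_eq_integral:
  assumes "x \<ge> 0"
  shows "erfc x = 1 - 2 / sqrt pi * integral {0..x} (\<lambda>t. exp (- t\<^sup>2))"
  unfolding erfc_def
  using interval_integral_eq_integral[OF assms, of "\<lambda>t. exp (- t\<^sup>2)"] set_integrable_exp_neg_square
  by (simp add: zero_ereal_def)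

lemma erfc_le_1: "x \<ge> 0 \<Longrightarrow> erfc x \<le> 1"
  by (simp add: erfc_eq_integral integral_nonneg integrable_continuous_real continuous_intros)

lemma erfc_nonneg:
  assumes "x \<ge> 0"
  shows "erfc x \<ge> 0"
proof -
  have "integral {0..x} (\<lambda>t. exp (- t\<^sup>2)) = (LINT t|lborel. indicator {0..x} t *\<^sub>R exp (- t\<^sup>2))"
    using set_borel_integral_eq_integral(2)[OF set_integrable_exp_neg_square]
    by (simp add: set_lebesgue_integral_def)
  also have "\<dots> \<le> (LINT t|lborel. indicator {0..} t *\<^sub>R exp (- t\<^sup>2))"
    using set_integrable_exp_neg_square gaussian_moment_0
    by (intro integral_mono) (auto simp: set_integrable_def has_bochner_integral_iff split: split_indicator)
  also have "\<dots> = sqrt pi / 2"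
    using gaussian_moment_0 by (rule has_bochner_integral_integral_eq)
  finally have "2 / sqrt pi * integral {0..x} (\<lambda>t. exp (- t\<^sup>2)) \<le> 2 / sqrt pi * (sqrt pi / 2)"
    by (rule mult_left_mono) simp
  then show ?thesis using assms by (simp add: erfc_eq_integral)
qed

lemma erfc_has_deriv:
  assumes x: "x > 0"
  shows "(erfc has_real_derivative - (2 / sqrt pi * exp (- x\<^sup>2))) (at x)"
proof -
  have "((\<lambda>u. integral {0..u} (\<lambda>t. exp (- t\<^sup>2))) has_real_derivative exp (- x\<^sup>2)) (at x within {0..x + 1})"
    by (rule integral_has_real_derivative) (use x in \<open>auto intro!: continuous_intros\<close>)
  then have d: "((\<lambda>u. integral {0..u} (\<lambda>t. exp (- t\<^sup>2))) has_real_derivative exp (- x\<^sup>2)) (at x)"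
    using x by (subst (asm) at_within_interior) auto
  have "((\<lambda>u. 1 - 2 / sqrt pi * integral {0..u} (\<lambda>t. exp (- t\<^sup>2))) has_real_derivative
      - (2 / sqrt pi * exp (- x\<^sup>2))) (at x)"
    using DERIV_diff[OF DERIV_const[of 1] DERIV_cmult[OF d, of "2 / sqrt pi"]] by simp
  \<comment> \<open>Within distance x of x the argument is positive, so the formula of
    \<open>erfc_eq_integral\<close> holds there.\<close>
  then show ?thesis
    by (rule has_field_derivative_transform_within[where d = x]) (use x in \<open>auto simp: erfc_eq_integral dist_real_def\<close>)
qed

lemma exp_neg_square_has_deriv: "((\<lambda>t. exp (- t\<^sup>2)) has_real_derivative - (2 * t * exp (- t\<^sup>2))) (at t)"
  by (auto intro!: derivative_eq_intros)

lemma divide_var_has_deriv: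
  fixes t :: real
  assumes "t \<noteq> 0"
  shows "((\<lambda>t. C / (k * t)) has_real_derivative - (C / (k * t\<^sup>2))) (at t)"
proof (cases "k = 0")
  case False
  then show ?thesis
    using assms by (auto intro!: derivative_eq_intros simp: power2_eq_square)
qed simp

text \<open>Let c = sqrt 2 * pi * l. Then - c times this derivative is \<open>gamma_term\<close>
  plus the contribution of 1 / (2 * t^2). The surplus reflects the classical estimate of the
  integral of exp (- x^2) over [t, oo) by exp (- t^2) / (2 * t).\<close>

lemma A_term_has_deriv:
  assumes l: "l > 0" and t: "t > 0"
  shows "((\<lambda>t. A_term t l) has_real_derivative
    - (exp (- t\<^sup>2) / sqrt pi * (1 + 1 / (2 * t\<^sup>2)) + gauss_tail l / (sqrt 2 * l * pi * t\<^sup>2))) (at t)"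
proof -
  have "((\<lambda>t. 1 / (2 * sqrt pi * t) * exp (- t\<^sup>2) + gauss_tail l / (sqrt 2 * l * pi * t)) has_real_derivative
      (1 / (2 * sqrt pi * t) * - (2 * t * exp (- t\<^sup>2)) + - (1 / (2 * sqrt pi * t\<^sup>2)) * exp (- t\<^sup>2)) +
      - (gauss_tail l / (sqrt 2 * l * pi * t\<^sup>2))) (at t)"
    using t by (intro DERIV_add DERIV_mult' exp_neg_square_has_deriv divide_var_has_deriv) auto
  moreover have "1 / (2 * sqrt pi * t) * - (2 * t * exp (- t\<^sup>2)) + - (1 / (2 * sqrt pi * t\<^sup>2)) * exp (- t\<^sup>2) =
      - (exp (- t\<^sup>2) / sqrt pi * (1 + 1 / (2 * t\<^sup>2)))"
    using t by (simp add: distrib_left)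
  ultimately show ?thesis
    unfolding A_term_eq[OF l] by (simp add: mult_ac)
qed

text \<open>Again - c times the derivative is \<open>xi_term\<close> plus a surplus, now from 1 / (4
  * t^2). The erfc term and the following one integrate x^2 * exp (- x^2) over [t, oo) exactly, up
  to the factor 1 / sqrt pi. The third term estimates the integral of exp (- x^2) / 2.\<close>

lemma S_term_has_deriv:
  assumes l: "l > 0" and t: "t > 0"
  shows "((\<lambda>t. S_term t l) has_real_derivative
    - (exp (- t\<^sup>2) / sqrt pi * (t\<^sup>2 + 1/2 + 1 / (4 * t\<^sup>2)) + dgauss_tail l / (sqrt 2 * l * pi * t\<^sup>2))) (at t)"
proof -
  let ?p = "sqrt pi" and ?e = "exp (- t\<^sup>2)"
  have "((\<lambda>t. erfc t / 4 + 1 / (2 * ?p) * t * exp (- t\<^sup>2) + 1 / (4 * ?p * t) * exp (- t\<^sup>2) +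
      dgauss_tail l / (sqrt 2 * l * pi * t)) has_real_derivative
      - (2 / ?p * ?e) / 4 + (1 / (2 * ?p) * t * - (2 * t * ?e) + 1 / (2 * ?p) * 1 * ?e) +
      (1 / (4 * ?p * t) * - (2 * t * ?e) + - (1 / (4 * ?p * t\<^sup>2)) * ?e) +
      - (dgauss_tail l / (sqrt 2 * l * pi * t\<^sup>2))) (at t)"
    using t by (intro DERIV_add DERIV_mult' DERIV_cmult DERIV_ident DERIV_cdivide erfc_has_deriv
        exp_neg_square_has_deriv divide_var_has_deriv) auto
  moreover have "- (2 / ?p * ?e) / 4 + (1 / (2 * ?p) * t * - (2 * t * ?e) + 1 / (2 * ?p) * 1 * ?e) +
      (1 / (4 * ?p * t) * - (2 * t * ?e) + - (1 / (4 * ?p * t\<^sup>2)) * ?e) =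
      - (?e / ?p * (t\<^sup>2 + 1/2 + 1 / (4 * t\<^sup>2)))"
    using t by (simp add: distrib_left power2_eq_square mult_ac)
  ultimately show ?thesis
    unfolding S_term_eq[OF l] by (simp add: mult_ac)
qed

lemma gamma_term_antimono:
  assumes l: "l > 0" and t: "0 < s" "s \<le> t"
  shows "gamma_term t l \<le> gamma_term s l"
  unfolding gamma_term_eq using assms gauss_tail_nonneg[OF l]
  by (intro add_mono mult_left_mono divide_left_mono) (auto intro: power_mono)

text \<open>In terms of d = t^2 - s^2, the product (s^2 + 1/2) * (1 + d) exceeds t^2 + 1/2 by (s^2 -
  1/2) * d, which is nonnegative because s \<ge> 1. Then 1 + d \<le> exp d replaces a discussion of
  derivatives.\<close>

lemma xi_term_antimono:
  assumes l: "l > 0" and t: "1 \<le> s" "s \<le> t"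
  shows "xi_term t l \<le> xi_term s l"
proof -
  define d where "d = t\<^sup>2 - s\<^sup>2"
  have d: "d \<ge> 0" using power_mono[OF t(2), of 2] t(1) by (simp add: d_def)
  have s: "1 \<le> s\<^sup>2" using power_mono[OF t(1), of 2] by simp
  have "t\<^sup>2 + 1/2 \<le> (s\<^sup>2 + 1/2) * (1 + d)"
    using mult_left_mono[OF d, of "s\<^sup>2 - 1/2"] mult_mono[of 1 "s\<^sup>2" d d] s d
    by (simp add: d_def algebra_simps)
  also have "\<dots> \<le> (s\<^sup>2 + 1/2) * exp d"
    by (intro mult_left_mono exp_ge_add_one_self) simp
  finally have "(t\<^sup>2 + 1/2) * exp (- t\<^sup>2) \<le> (s\<^sup>2 + 1/2) * exp d * exp (- t\<^sup>2)"
    by (rule mult_right_mono) simp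
  also have "\<dots> = (s\<^sup>2 + 1/2) * exp (- s\<^sup>2)"
    by (simp add: d_def mult.assoc flip: exp_add)
  finally have "l * sqrt (2 * pi) * ((t\<^sup>2 + 1/2) * exp (- t\<^sup>2)) \<le> l * sqrt (2 * pi) * ((s\<^sup>2 + 1/2) * exp (- s\<^sup>2))"
    by (rule mult_left_mono) (use l in simp)
  moreover have "dgauss_tail l / t\<^sup>2 \<le> dgauss_tail l / s\<^sup>2"
    using t dgauss_tail_nonneg[OF l] by (intro divide_left_mono power_mono) auto
  ultimately show ?thesis unfolding xi_term_eq by (simp add: mult_ac)
qed

lemma sum_gamma_term_le:
  assumes l: "l > 0" and M: "M > 0"
  shows "(\<Sum>k\<in>{M<..N}. gamma_term (sqrt 2 * pi * l * real k) l) \<le> A_term (sqrt 2 * pi * l * real M) l"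
proof -
  define c where "c = sqrt 2 * pi * l"
  have c: "c > 0" using l by (simp add: c_def)
  define D where "D t = - (exp (- t\<^sup>2) / sqrt pi * (1 + 1 / (2 * t\<^sup>2)) + gauss_tail l / (sqrt 2 * l * pi * t\<^sup>2))" for t
  have pos: "c * x > 0" if "real M \<le> x" for x using c M that by simp
  have "(\<Sum>k\<in>{M<..N}. gamma_term (c * real k) l) \<le> A_term (c * real M) l"
  proof (rule sum_le_of_antiderivative[where F = "\<lambda>x. A_term (c * x) l" and F' = "\<lambda>x. D (c * x) * c"])
    show "((\<lambda>x. A_term (c * x) l) has_real_derivative D (c * x) * c) (at x)" if "real M \<le> x" for x
      unfolding D_def by (rule DERIV_chain2[where g = "\<lambda>x. c * x", OF A_term_has_deriv[OF l pos[OF that]]])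
        (auto intro!: derivative_eq_intros)
    show "A_term (c * x) l \<ge> 0" if "real M \<le> x" for x
      using pos[OF that] l gauss_tail_nonneg[OF l] by (simp add: A_term_eq)
    fix x y assume xy: "real M \<le> x" "x \<le> y"
    have "gamma_term (c * y) l \<le> gamma_term (c * x) l"
      using xy c pos[OF xy(1)] by (intro gamma_term_antimono[OF l]) auto
    also have "\<dots> \<le> - (D (c * x) * c)"
    proof -
      define t where "t = c * x"
      have t: "t > 0" using pos[OF xy(1)] by (simp add: t_def)
      have "c / sqrt pi = l * sqrt (2 * pi)"
        by (simp add: c_def real_sqrt_mult field_simps)
      moreover have "c / sqrt pi * exp (- t\<^sup>2) * 1 \<le> c / sqrt pi * exp (- t\<^sup>2) * (1 + 1 / (2 * t\<^sup>2))"
        using c by (intro mult_left_mono) auto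
      moreover have "gauss_tail l / (sqrt 2 * l * pi * t\<^sup>2) * c = gauss_tail l / t\<^sup>2"
        using l t by (simp add: c_def field_simps)
      moreover have "- (D t * c) = c / sqrt pi * exp (- t\<^sup>2) * (1 + 1 / (2 * t\<^sup>2)) + gauss_tail l / (sqrt 2 * l * pi * t\<^sup>2) * c"
        by (simp add: D_def algebra_simps)
      moreover have "gamma_term t l = l * sqrt (2 * pi) * exp (- t\<^sup>2) * 1 + gauss_tail l / t\<^sup>2"
        by (simp add: gamma_term_eq mult_ac)
      ultimately show ?thesis
        unfolding t_def[symmetric] by (simp only:)
    qed
    finally show "gamma_term (c * y) l \<le> - (D (c * x) * c)" .
  qed
  then show ?thesis by (simp add: c_def)
qed

lemma sum_xi_term_le:
  assumes l: "l > 0" and M: "M > 0" "sqrt 2 * pi * l * real M \<ge> 1"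
  shows "(\<Sum>k\<in>{M<..N}. xi_term (sqrt 2 * pi * l * real k) l) \<le> S_term (sqrt 2 * pi * l * real M) l"
proof -
  define c where "c = sqrt 2 * pi * l"
  have c: "c > 0" using l by (simp add: c_def)
  define D where "D t = - (exp (- t\<^sup>2) / sqrt pi * (t\<^sup>2 + 1/2 + 1 / (4 * t\<^sup>2)) + dgauss_tail l / (sqrt 2 * l * pi * t\<^sup>2))" for t
  have ge1: "c * x \<ge> 1" if "real M \<le> x" for x
  proof -
    have "1 \<le> c * real M" using M(2) by (simp add: c_def)
    also have "\<dots> \<le> c * x" using that c by simp
    finally show ?thesis .
  qed
  have pos: "c * x > 0" if "real M \<le> x" for x using ge1[OF that] by linarith
  have "(\<Sum>k\<in>{M<..N}. xi_term (c * real k) l) \<le> S_term (c * real M) l"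
  proof (rule sum_le_of_antiderivative[where F = "\<lambda>x. S_term (c * x) l" and F' = "\<lambda>x. D (c * x) * c"])
    show "((\<lambda>x. S_term (c * x) l) has_real_derivative D (c * x) * c) (at x)" if "real M \<le> x" for x
      unfolding D_def by (rule DERIV_chain2[where g = "\<lambda>x. c * x", OF S_term_has_deriv[OF l pos[OF that]]])
        (auto intro!: derivative_eq_intros)
    show "S_term (c * x) l \<ge> 0" if "real M \<le> x" for x
      using pos[OF that] l dgauss_tail_nonneg[OF l] erfc_nonneg[of "c * x"] by (simp add: S_term_eq)
    fix x y assume xy: "real M \<le> x" "x \<le> y"
    have "xi_term (c * y) l \<le> xi_term (c * x) l"
      using xy c ge1[OF xy(1)] by (intro xi_term_antimono[OF l]) auto
    also have "\<dots> \<le> - (D (c * x) * c)"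
    proof -
      define t where "t = c * x"
      have t: "t > 0" using pos[OF xy(1)] by (simp add: t_def)
      have "c / sqrt pi = l * sqrt (2 * pi)"
        by (simp add: c_def real_sqrt_mult field_simps)
      moreover have "c / sqrt pi * exp (- t\<^sup>2) * (t\<^sup>2 + 1/2) \<le> c / sqrt pi * exp (- t\<^sup>2) * (t\<^sup>2 + 1/2 + 1 / (4 * t\<^sup>2))"
        using c by (intro mult_left_mono) auto
      moreover have "dgauss_tail l / (sqrt 2 * l * pi * t\<^sup>2) * c = dgauss_tail l / t\<^sup>2"
        using l t by (simp add: c_def field_simps)
      moreover have "- (D t * c) = c / sqrt pi * exp (- t\<^sup>2) * (t\<^sup>2 + 1/2 + 1 / (4 * t\<^sup>2)) + dgauss_tail l / (sqrt 2 * l * pi * t\<^sup>2) * c"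
        by (simp add: D_def algebra_simps)
      moreover have "xi_term t l = l * sqrt (2 * pi) * exp (- t\<^sup>2) * (t\<^sup>2 + 1/2) + dgauss_tail l / t\<^sup>2"
        by (simp add: xi_term_eq mult_ac)
      ultimately show ?thesis
        unfolding t_def[symmetric] by (simp only:)
    qed
    finally show "xi_term (c * y) l \<le> - (D (c * x) * c)" .
  qed
  then show ?thesis by (simp add: c_def)
qed



section \<open>Numerical bounds and the absorption of the products\<close>

lemma sqrt_2_ge: "sqrt 2 \<ge> (141/100::real)"
  by (rule real_le_rsqrt) (simp add: power2_eq_square)

lemma sqrt_pi_ge: "sqrt pi \<ge> 17/10"
  by (rule real_le_rsqrt) (use pi_gt3 in \<open>simp add: power2_eq_square\<close>)

lemma sqrt_2_mult_pi_ge: "sqrt 2 * pi \<ge> 423/100"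
  using mult_mono[OF sqrt_2_ge less_imp_le[OF pi_gt3]] by simp

lemma exp_neg_half_le: "exp (- (1/2::real)) \<le> 61/100"
proof -
  have "(164/100::real)\<^sup>2 \<le> exp 1" using exp_1_gt by (simp add: power2_eq_square)
  also have "exp 1 = (exp (1/2::real))\<^sup>2" by (simp flip: exp_double)
  finally have "164/100 \<le> exp (1/2::real)" by (rule power2_le_imp_le) simp
  then show ?thesis by (simp add: exp_minus field_simps)
qed

lemma mult_exp_neg_square_le:
  fixes x :: real
  assumes "x \<ge> 1"
  shows "x * exp (- x\<^sup>2) \<le> 10/27"
proof -
  have "x \<le> x\<^sup>2" using assms by (simp add: power2_eq_square)
  also have "\<dots> \<le> exp (x\<^sup>2 - 1)" using exp_ge_add_one_self[of "x\<^sup>2 - 1"] by simp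
  finally have "x * exp (- x\<^sup>2) \<le> exp (x\<^sup>2 - 1) * exp (- x\<^sup>2)" by (rule mult_right_mono) simp
  also have "\<dots> = exp (- 1)" by (simp flip: exp_add)
  also have "\<dots> \<le> 10/27" using exp_1_gt by (simp add: exp_minus field_simps)
  finally show ?thesis .
qed

text \<open>The maximum 4 * exp (- 2) is attained at z = 2. It follows from squaring z / 2 \<le> exp
  (z / 2 - 1).\<close>

lemma square_mult_exp_neg_le:
  fixes z :: real
  assumes "z \<ge> 0"
  shows "z\<^sup>2 * exp (- z) \<le> 4/7"
proof -
  have "z / 2 \<le> exp (z / 2 - 1)" using exp_ge_add_one_self[of "z / 2 - 1"] by simp
  then have "(z / 2)\<^sup>2 \<le> (exp (z / 2 - 1))\<^sup>2" using assms by (intro power_mono) auto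
  also have "\<dots> = exp (z - 2)" by (simp flip: exp_double)
  finally have "4 * (z / 2)\<^sup>2 * exp (- z) \<le> 4 * exp (z - 2) * exp (- z)" by simp
  also have "\<dots> = 4 * exp (- 2)" by (simp add: mult.assoc flip: exp_add)
  also have "\<dots> \<le> 4/7" using exp_2_gt by (simp add: exp_minus field_simps)
  finally show ?thesis by (simp add: power_divide)
qed

text \<open>The second case of the definition dominates the first: for w = 1 / (2 * l) this says
  that w * exp (- w^2 / 2) is largest at w = 1. Linearity in l matters because only l / \<eta> is
  bounded.\<close>

lemma gauss_tail_le:
  assumes l: "l > 0"
  shows "gauss_tail l \<le> 61/50 * l"
proof -
  have "gauss_tail l \<le> 2 * l * exp (- (1/2))"
  proof (cases "l < 1/2")
    case True
    define w where "w = 1 / (2 * l)"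
    have w2: "w\<^sup>2 / 2 = 1 / (8 * l\<^sup>2)" by (simp add: w_def power_divide power_mult_distrib)
    have "w \<le> 1 + (w\<^sup>2 / 2 - 1/2)"
      using zero_le_power2[of "w - 1"] unfolding power2_diff by simp
    also have "\<dots> \<le> exp (w\<^sup>2 / 2 - 1/2)" by (rule exp_ge_add_one_self)
    finally have "w * exp (- (w\<^sup>2 / 2)) \<le> exp (w\<^sup>2 / 2 - 1/2) * exp (- (w\<^sup>2 / 2))"
      by (rule mult_right_mono) simp
    also have "\<dots> = exp (- (1/2))" by (simp flip: exp_add)
    finally have "2 * l * (w * exp (- (w\<^sup>2 / 2))) \<le> 2 * l * exp (- (1/2))"
      by (rule mult_left_mono) (use l in simp)
    moreover have "2 * l * w = 1" using l by (simp add: w_def)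
    ultimately show ?thesis using True w2 by (simp add: gauss_tail_def flip: mult.assoc)
  qed (simp add: gauss_tail_def)
  also have "\<dots> \<le> 2 * l * (61/100)" using l by (intro mult_left_mono exp_neg_half_le) simp
  finally show ?thesis by simp
qed

text \<open>The second case determines the constant: there l \<ge> 10/43, so 1 \<le> 43/10 * l, and
  43/10 + 3/2 = 29/5. In the first case the tail is y * exp (- y) with 1 / y = 8 * l^2, and writing
  it as (1 / y) * (y^2 * exp (- y)) gains l^2, one factor of which is at most 1/4.\<close>

lemma dgauss_tail_le:
  assumes l: "l > 0"
  shows "dgauss_tail l \<le> 29/5 * l"
proof (cases "l \<le> 1/2 * sqrt (2 / (5 + sqrt 17))")
  case True
  have "sqrt (2 / (5 + sqrt 17)) \<le> 1/2"
    by (rule real_le_lsqrt) (use sqrt_17_bounds in \<open>simp_all add: power2_eq_square field_simps\<close>)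
  with True have l4: "l \<le> 1/4" by linarith
  define y where "y = 1 / (8 * l\<^sup>2)"
  have y: "y > 0" using l by (simp add: y_def)
  have "dgauss_tail l = 8 * l\<^sup>2 * (y\<^sup>2 * exp (- y))"
    using True l by (simp add: dgauss_tail_def y_def power2_eq_square)
  also have "\<dots> \<le> 8 * l\<^sup>2 * (4/7)"
    using y by (intro mult_left_mono square_mult_exp_neg_le) auto
  also have "\<dots> \<le> 8 * (l * (1/4)) * (4/7)"
    using l l4 by (simp add: power2_eq_square)
  finally show ?thesis using l by simp
next
  case False
  have "20/43 \<le> sqrt (2 / (5 + sqrt 17))"
    by (rule real_le_rsqrt) (use sqrt_17_bounds in \<open>simp add: power2_eq_square field_simps\<close>)
  with False have "10/43 \<le> l" by linarith
  then show ?thesis using False by (simp add: dgauss_tail_def)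
qed

lemma tail_div_square_le:
  fixes C D l \<eta> :: real
  assumes "C \<le> D * l" "l > 0" "423/100 * l \<le> \<eta>" "\<eta> \<ge> 1" "D \<ge> 0"
  shows "C / \<eta>\<^sup>2 \<le> D / (423/100)"
proof -
  have "423/100 * C \<le> D * (423/100 * l)" using assms(1) by simp
  also have "\<dots> \<le> D * \<eta>" by (rule mult_left_mono) (use assms in auto)
  also have "\<dots> \<le> D * \<eta>\<^sup>2" using assms by (intro mult_left_mono) (auto simp: power2_eq_square)
  finally show ?thesis using assms by (simp add: field_simps)
qed

lemma tail_div_le:
  assumes "C \<le> D * l" "l > 0" "\<eta> \<ge> 1" "D \<ge> 0"
  shows "C / (sqrt 2 * l * pi * \<eta>) \<le> D / (423/100)"
proof -
  have "423/100 * 1 \<le> (sqrt 2 * pi) * \<eta>"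
    by (intro mult_mono sqrt_2_mult_pi_ge) (use assms in auto)
  then have "D * l * (423/100) \<le> D * l * (sqrt 2 * pi * \<eta>)"
    using assms by (intro mult_left_mono) auto
  moreover have "C * (423/100) \<le> D * l * (423/100)" using assms by simp
  ultimately have "C * (423/100) \<le> D * (sqrt 2 * l * pi * \<eta>)" by (simp add: mult_ac)
  then show ?thesis using assms by (simp add: field_simps)
qed

text \<open>The assumption on l says that the grid has m \<ge> 2.\<close>
lemma term_bounds:
  assumes l: "l > 0" and \<eta>: "\<eta> \<ge> 1" and le: "sqrt 2 * pi * l \<le> \<eta>"
  shows "gamma_term \<eta> l \<le> 13/25" "A_term \<eta> l \<le> 2/5" "xi_term \<eta> l \<le> 2" "S_term \<eta> l \<le> 2"
proof -
  have le': "423/100 * l \<le> \<eta>"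
    using mult_right_mono[OF sqrt_2_mult_pi_ge, of l] l le by linarith
  define e where "e = exp (- \<eta>\<^sup>2)"
  have e: "0 < e" "\<eta> * e \<le> 10/27" using mult_exp_neg_square_le[OF \<eta>] by (simp_all add: e_def)
  have e1: "e \<le> 10/27" using e \<eta> mult_right_mono[of 1 \<eta> e] by linarith
  \<comment> \<open>This identity turns the assumption into l * sqrt (2 * pi) \<le> \<eta> / sqrt
    pi, so the Gaussian parts can be bounded by powers of \<eta> times exp (- \<eta>^2).\<close>
  have "l * sqrt (2 * pi) * sqrt pi = sqrt 2 * pi * l" by (simp add: real_sqrt_mult)
  moreover have "l * sqrt (2 * pi) * (17/10) \<le> l * sqrt (2 * pi) * sqrt pi"
    by (rule mult_left_mono[OF sqrt_pi_ge]) (use l in simp)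
  ultimately have "l * sqrt (2 * pi) * (17/10) \<le> \<eta>" using le by linarith
  then have lp: "l * sqrt (2 * pi) \<le> 10/17 * \<eta>" by simp
  have lpe: "l * sqrt (2 * pi) * e \<le> 10/17 * (10/27)"
    using mult_right_mono[OF lp, of e] e by linarith
  have isp: "1 / sqrt pi \<le> 10/17" using sqrt_pi_ge by (simp add: field_simps)
  note g = gauss_tail_le[OF l] and d = dgauss_tail_le[OF l]
  show "gamma_term \<eta> l \<le> 13/25"
    unfolding gamma_term_eq e_def[symmetric]
    using lpe tail_div_square_le[OF g l le' \<eta>] by simp
  have "1 / (2 * \<eta> * sqrt pi) * e = 1/2 * (1 / sqrt pi) * (e / \<eta>)" by simp
  also have "\<dots> \<le> 1/2 * (10/17) * (10/27)"
    using isp e1 e \<eta> by (intro mult_mono) (auto simp: divide_simps)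
  finally have A1: "1 / (2 * \<eta> * sqrt pi) * e \<le> 1/2 * (10/17) * (10/27)" .
  then show "A_term \<eta> l \<le> 2/5"
    unfolding A_term_eq[OF l] e_def[symmetric]
    using tail_div_le[OF g l \<eta>] by simp
  have "(\<eta>\<^sup>2 + 1/2) * (l * sqrt (2 * pi)) * e \<le> (3/2 * \<eta>\<^sup>2) * (10/17 * \<eta>\<^sup>2) * e"
  proof (rule mult_right_mono[OF mult_mono])
    have "1 \<le> \<eta>\<^sup>2" using \<eta> by simp
    then show "\<eta>\<^sup>2 + 1/2 \<le> 3/2 * \<eta>\<^sup>2" by simp
    show "l * sqrt (2 * pi) \<le> 10/17 * \<eta>\<^sup>2" 
      using \<eta> by (intro order_trans[OF lp]) (simp add: power2_eq_square)
  qed (use l e in auto)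
  also have "\<dots> = 15/17 * ((\<eta>\<^sup>2)\<^sup>2 * exp (- \<eta>\<^sup>2))" by (simp add: e_def power2_eq_square)
  also have "\<dots> \<le> 15/17 * (4/7)" by (intro mult_left_mono square_mult_exp_neg_le) auto
  finally have "(\<eta>\<^sup>2 + 1/2) * l * sqrt (2 * pi) * e \<le> 15/17 * (4/7)" by (simp add: mult.assoc)
  then show "xi_term \<eta> l \<le> 2"
    unfolding xi_term_eq e_def[symmetric]
    using tail_div_square_le[OF d l le' \<eta>] by simp
  have "\<eta> / (2 * sqrt pi) * e = 1/2 * (1 / sqrt pi) * (\<eta> * e)" by simp
  also have "\<dots> \<le> 1/2 * (10/17) * (10/27)"
    using isp e \<eta> by (intro mult_mono) auto
  finally have S1: "\<eta> / (2 * sqrt pi) * e \<le> 1/2 * (10/17) * (10/27)" .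
  have S2: "1 / (4 * sqrt pi * \<eta>) * e \<le> 1/4 * (10/17) * (10/27)"
    using A1 by (simp add: mult_ac)
  show "S_term \<eta> l \<le> 2"
    unfolding S_term_eq[OF l] e_def[symmetric]
    using S1 S2 tail_div_le[OF d l \<eta>] erfc_le_1[of \<eta>] \<eta> by simp
qed

text \<open>A comparison of coefficients. The bounds on \<gamma> and A give \<alpha> \<le> 26/25 +
  8/5 = 66/25, so the powers of \<alpha> reduce to linear terms with 116/25 = 2 + 66/25. In the
  expansion of \<alpha> * \<beta>, the product \<gamma> * S is absorbed by S and A * \<xi> by A. Of
  \<gamma> * \<xi> and A * S only the excess over the same products on the right has to be absorbed,
  by \<xi> and A.\<close>

lemma tensor_bound_less_error_terms:
  fixes \<gamma> A \<xi> S :: real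
  assumes pos: "\<gamma> > 0" "A > 0" "\<xi> > 0" "S > 0"
    and le: "\<gamma> \<le> 13/25" "A \<le> 2/5" "\<xi> \<le> 2" "S \<le> 2"
  defines "\<alpha> \<equiv> 2 * \<gamma> + 4 * A" and "\<beta> \<equiv> 2 * \<xi> + 4 * S"
  shows "3 * (\<beta> * (1 + \<alpha>)\<^sup>2 + 2 * \<alpha> + \<alpha>\<^sup>2) <
    (5/2 * \<xi> + 15 * \<gamma>) * (15 + 12 * \<gamma>) + 75 * S + 6 * A * (116/5 * S + 87)"
proof -
  have \<alpha>: "0 \<le> \<alpha>" "\<alpha> \<le> 66/25" and \<beta>: "0 \<le> \<beta>" using pos le by (auto simp: \<alpha>_def \<beta>_def)
  have \<alpha>2: "\<alpha>\<^sup>2 \<le> 66/25 * \<alpha>" using mult_right_mono[OF \<alpha>(2) \<alpha>(1)] by (simp add: power2_eq_square)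
  have \<beta>\<alpha>: "\<beta> * (1 + \<alpha>)\<^sup>2 \<le> \<beta> + 116/25 * (\<alpha> * \<beta>)"
  proof -
    have "(1 + \<alpha>)\<^sup>2 \<le> 1 + 116/25 * \<alpha>" using \<alpha>2 by (simp add: power2_sum)
    then have "\<beta> * (1 + \<alpha>)\<^sup>2 \<le> \<beta> * (1 + 116/25 * \<alpha>)" using \<beta> by (rule mult_left_mono)
    then show ?thesis by (simp add: algebra_simps)
  qed
  have prod: "\<alpha> * \<beta> = 4 * (\<gamma> * \<xi>) + 8 * (\<gamma> * S) + 8 * (A * \<xi>) + 16 * (A * S)"
    by (simp add: \<alpha>_def \<beta>_def algebra_simps)
  have "\<gamma> * \<xi> \<le> 13/25 * \<xi>" "\<gamma> * S \<le> 13/25 * S" "A * \<xi> \<le> 2 * A" "A * S \<le> 2 * A"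
    using mult_right_mono[OF le(1), of \<xi>] mult_right_mono[OF le(1), of S]
      mult_left_mono[OF le(3), of A] mult_left_mono[OF le(4), of A] pos by (simp_all add: mult.commute)
  moreover have "0 \<le> \<gamma> * \<xi>" "0 \<le> \<gamma> * \<gamma>" using pos by simp_all
  moreover have "(5/2 * \<xi> + 15 * \<gamma>) * (15 + 12 * \<gamma>) + 75 * S + 6 * A * (116/5 * S + 87) =
      75/2 * \<xi> + 30 * (\<gamma> * \<xi>) + 225 * \<gamma> + 180 * (\<gamma> * \<gamma>) + 75 * S + 696/5 * (A * S) + 522 * A"
    by (simp add: algebra_simps)
  moreover have "3 * (\<beta> * (1 + \<alpha>)\<^sup>2 + 2 * \<alpha> + \<alpha>\<^sup>2) \<le> 3 * \<beta> + 348/25 * (\<alpha> * \<beta>) + 348/25 * \<alpha>"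
  proof -
    have "3 * (T + 2 * \<alpha> + Q) \<le> 3 * \<beta> + 348/25 * P + 348/25 * \<alpha>"
      if "Q \<le> 66/25 * \<alpha>" "T \<le> \<beta> + 116/25 * P" for T Q P
      using that by argo
    then show ?thesis using \<alpha>2 \<beta>\<alpha> .
  qed
  ultimately show ?thesis
    unfolding prod using pos unfolding \<alpha>_def \<beta>_def by argo
qed

theorem theorem3p4:
  fixes l \<eta> :: real and m :: nat
  assumes "l > 0" and "m > 0" and "even m"
    and "\<eta> = l * pi * real m / sqrt 2" and "\<eta> \<ge> 1"
  shows "sup_norm_cube (fourier_err (der_gauss_kernel l) m) <
    (5/2 * xi_term \<eta> l + 15 * gamma_term \<eta> l) * (15 + 12 * gamma_term \<eta> l)
    + 75 * S_term \<eta> l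
    + 6 * A_term \<eta> l * (116/5 * S_term \<eta> l + 87)"
proof -
  note l = assms(1) and \<eta>1 = assms(5)
  obtain M where m: "m = 2 * M" using assms(3) by (auto elim: evenE)
  have M: "M > 0" using assms(2) m by simp
  have \<eta>: "sqrt 2 * pi * l * real M = \<eta>"
  proof -
    have "\<eta> * sqrt 2 = 2 * (l * pi * real M)" using assms(4) m by simp
    also have "\<dots> = (sqrt 2 * pi * l * real M) * sqrt 2" by simp
    finally show ?thesis by simp
  qed
  have l\<eta>: "sqrt 2 * pi * l \<le> \<eta>"
    using mult_left_mono[of 1 "real M" "sqrt 2 * pi * l"] M l \<eta> by simp
  have gauss: "norm (of_real (periodic (gauss l) x) - trig_interp (\<lambda>y. of_real (periodic (gauss l) y)) m x)
      \<le> 2 * gamma_term \<eta> l + 4 * A_term \<eta> l" for x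
    unfolding m
  proof (rule trig_interp_error_le[OF continuous_on_gauss[OF l] _ M])
    show "\<bar>cos_coeff (gauss l) M\<bar> \<le> gamma_term \<eta> l"
      using cos_coeff_gauss_le[OF l M] \<eta> by simp
    show "(\<Sum>k\<in>{M<..N}. \<bar>cos_coeff (gauss l) k\<bar>) \<le> A_term \<eta> l" for N
      using sum_gamma_term_le[OF l M, of N] \<eta>
      by (intro order_trans[OF sum_mono[OF cos_coeff_gauss_le[OF l]]]) auto
  qed (simp add: gauss_def)
  have dgauss: "norm (of_real (periodic (dgauss l) x) - trig_interp (\<lambda>y. of_real (periodic (dgauss l) y)) m x)
      \<le> 2 * xi_term \<eta> l + 4 * S_term \<eta> l" for x
    unfolding m
  proof (rule trig_interp_error_le[OF continuous_on_dgauss[OF l] _ M])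
    show "\<bar>cos_coeff (dgauss l) M\<bar> \<le> xi_term \<eta> l"
      using cos_coeff_dgauss_le[OF l M] \<eta> by simp
    show "(\<Sum>k\<in>{M<..N}. \<bar>cos_coeff (dgauss l) k\<bar>) \<le> S_term \<eta> l" for N
      using sum_xi_term_le[OF l M, of N] \<eta> \<eta>1
      by (intro order_trans[OF sum_mono[OF cos_coeff_dgauss_le[OF l]]]) auto
  qed (simp add: dgauss_def gauss_def)
  let ?\<alpha> = "2 * gamma_term \<eta> l + 4 * A_term \<eta> l" and ?\<beta> = "2 * xi_term \<eta> l + 4 * S_term \<eta> l"
  have "0 \<in> unit_cube" by (simp add: unit_cube_def)
  then have "sup_norm_cube (fourier_err (der_gauss_kernel l) m) \<le> 3 * (?\<beta> * (1 + ?\<alpha>)\<^sup>2 + 2 * ?\<alpha> + ?\<alpha>\<^sup>2)"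
    unfolding sup_norm_cube_def
    by (intro cSUP_least fourier_err_der_gauss_le[OF l gauss dgauss]) auto
  \<comment> \<open>The strictness is gained after the supremum, through which only a weak
    inequality passes.\<close>
  also have "\<dots> < (5/2 * xi_term \<eta> l + 15 * gamma_term \<eta> l) * (15 + 12 * gamma_term \<eta> l)
    + 75 * S_term \<eta> l + 6 * A_term \<eta> l * (116/5 * S_term \<eta> l + 87)"
  proof (rule tensor_bound_less_error_terms)
    have pos: "\<eta> > 0" using \<eta>1 by simp
    show "gamma_term \<eta> l > 0" "xi_term \<eta> l > 0" "A_term \<eta> l > 0" "S_term \<eta> l > 0"
      using l pos gauss_tail_nonneg[OF l] dgauss_tail_nonneg[OF l] erfc_nonneg[of \<eta>]
      by (simp_all add: gamma_term_eq xi_term_eq A_term_eq S_term_eq add_pos_nonneg add_nonneg_pos)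
  qed (use term_bounds[OF l \<eta>1 l\<eta>] in auto)
  finally show ?thesis .
qed

end
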